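(* Let $V\ge0$ be a function on $\mathbb Z^d$, $d\ge3$, such that its support $Y_V=\{x\in\mathbb Z^d:V(x)>0\}$ is weakly sparse. Then $V$ is a discrete Hardy weight if and only if $V$ is bounded. Moreover, the Hardy constant $H(V)$ satisfies the two-sided inequality $$C\|V\|_{\ell_\infty}\le H(V)\le C'\|V\|_{\ell_\infty},$$ where $C=\|(\mathbf I-\mathbf T)^{-1}\|^{-2}\mu^2$ and $C'=\|\mathbf I-\mathbf T\|^2\mu^2$, with $\mathbf T$ the operator from the definition of weak sparseness of the set $Y_V$.
   Context: For a function $u$ on $\mathbb Z^d$ put $Q_0[u]=\sum_{x\in\mathbb Z^d}\sum_{j=1}^d|u(x+1_j)-u(x)|^2$, where $1_j$ is the $j$-th standard basis vector. For $d\ge3$, $\mathcal H^1=\mathcal H^1(\mathbb Z^d)$ is the completion of the set of finitely supported functions on $\mathbb Z^d$ in the metric generated by $Q_0$; it is a Hilbert space of functions on $\mathbb Z^d$, and norms of operators are taken in it. A function $W\ge0$ on $\mathbb Z^d$ is a (discrete) Hardy weight if for some finite constant $H$ one has $\sum_{x\in\mathbb Z^d}W(x)|u(x)|^2\le H\,Q_0[u]$ for all $u\in\mathcal H^1(\mathbb Z^d)$; the best possible constant is the Hardy constant $H(W)$. Green function of the discrete Laplacian: with $\mathbb T^d=(\mathbb R/2\pi\mathbb Z)^d$, $$h_0(x)=(2\pi)^{-d}\int_{\mathbb T^d}\frac{e^{ixz}}{4\sum_{j=1}^d\sin^2(z_j/2)}\,dz,\qquad h_y(x)=h_0(x-y),\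 y\in\mathbb Z^d,$$ $\mu>0$ is defined by $\mu^2=h_0(0)$; the functions $h_y$ belong to $\mathcal H^1(\mathbb Z^d)$ and have norm $\mu$ there. Put $\widetilde h_y=\mu^{-1}h_y$. A set $Y\subset\mathbb Z^d$ is weakly sparse if there exists a bounded operator $\mathbf T$ in $\mathcal H^1(\mathbb Z^d)$ such that $\mathbf I-\mathbf T$ has bounded inverse and the functions $e_y=(\mathbf I-\mathbf T)^{-1}\widetilde h_y$, $y\in Y$, form an orthonormal system in $\mathcal H^1(\mathbb Z^d)$. *)

theory Defs
  imports "HOL-Analysis.Analysis"
begin

text \<open>
  The lattice of dimension \<open>d\<close> is \<open>int ^ 'd\<close> with \<open>d = CARD('d)\<close>, the basis vector \<open>1\<^sub>j\<close> being
  \<open>axis j 1\<close>. Functions on the lattice are complex valued.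
\<close>

definition energy_form ::
  "(int ^ 'd \<Rightarrow> complex) \<Rightarrow> (int ^ 'd \<Rightarrow> complex) \<Rightarrow> complex"
  where "energy_form u v =
    (\<Sum>\<^sub>\<infinity>x. \<Sum>j\<in>UNIV. (u (x + axis j 1) - u x) * cnj (v (x + axis j 1) - v x))"

text \<open>
  The infinite sums in \<open>energy_form\<close> and \<open>Q0\<close> converge absolutely for arguments in the space \<open>H1\<close>
  below, and they are only used there.
\<close>

definition Q0 :: "(int ^ 'd \<Rightarrow> complex) \<Rightarrow> real"
  where "Q0 u = (\<Sum>\<^sub>\<infinity>x. \<Sum>j\<in>UNIV. (cmod (u (x + axis j 1) - u x))\<^sup>2)"

definition H1_norm :: "(int ^ 'd \<Rightarrow> complex) \<Rightarrow> real"
  where "H1_norm u = sqrt (Q0 u)"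

text \<open>
  The completion is realised as a space of functions: for \<open>d \<ge> 3\<close>, a Cauchy sequence of finitely
  supported functions converges pointwise, its class in the completion is determined by the
  pointwise limit \<open>u\<close>, and the norm of this class is \<open>H1_norm u\<close>. Convergence in \<open>Q0\<close> alone would
  not determine \<open>u\<close>, since \<open>Q0\<close> vanishes on constants.
\<close>

definition H1 :: "(int ^ 'd \<Rightarrow> complex) set"
  where "H1 = {u. \<exists>\<phi> :: nat \<Rightarrow> int ^ 'd \<Rightarrow> complex.
     (\<forall>n. finite {x. \<phi> n x \<noteq> 0}) \<and>
     (\<forall>\<epsilon>>0. \<exists>N. \<forall>m\<ge>N. \<forall>n\<ge>N. H1_norm (\<lambda>x. \<phi> m x - \<phi> n x) < \<epsilon>) \<and>
     (\<forall>x. (\<lambda>n. \<phi> n x) \<longlonglongrightarrow> u x)}"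

text \<open>
  Operators in \<open>H1\<close> are functions on all lattice functions, of which only the restriction to \<open>H1\<close>
  matters.
\<close>

definition H1_bounded_operator ::
  "((int ^ 'd \<Rightarrow> complex) \<Rightarrow> (int ^ 'd \<Rightarrow> complex)) \<Rightarrow> bool"
  where "H1_bounded_operator A \<longleftrightarrow>
     (\<forall>u\<in>H1. A u \<in> H1) \<and>
     (\<forall>u\<in>H1. \<forall>v\<in>H1. A (\<lambda>x. u x + v x) = (\<lambda>x. A u x + A v x)) \<and>
     (\<forall>c. \<forall>u\<in>H1. A (\<lambda>x. c * u x) = (\<lambda>x. c * A u x)) \<and>
     (\<exists>K. \<forall>u\<in>H1. H1_norm (A u) \<le> K * H1_norm u)"

definition H1_opnorm :: "((int ^ 'd \<Rightarrow> complex) \<Rightarrow> (int ^ 'd \<Rightarrow> complex)) \<Rightarrow> real"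
  where "H1_opnorm A = (SUP u\<in>H1. H1_norm (A u) / H1_norm u)"

definition id_minus ::
  "((int ^ 'd \<Rightarrow> complex) \<Rightarrow> (int ^ 'd \<Rightarrow> complex)) \<Rightarrow> (int ^ 'd \<Rightarrow> complex) \<Rightarrow> (int ^ 'd \<Rightarrow> complex)"
  where "id_minus T u = (\<lambda>x. u x - T u x)"

definition H1_inverse ::
  "((int ^ 'd \<Rightarrow> complex) \<Rightarrow> (int ^ 'd \<Rightarrow> complex)) \<Rightarrow> (int ^ 'd \<Rightarrow> complex) \<Rightarrow> (int ^ 'd \<Rightarrow> complex)"
  where "H1_inverse A = inv_into H1 A"

text \<open>
  The torus is represented by the cube \<open>[-\<pi>, \<pi>]\<^sup>d\<close>, on which the integrand is Lebesgue integrable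
  for \<open>d \<ge> 3\<close>.
\<close>

definition green0 :: "int ^ 'd \<Rightarrow> complex"
  where "green0 x = of_real (1 / (2 * pi) ^ CARD('d)) *
     (LINT z : cbox (\<chi> j. - pi) (\<chi> j. pi) | (lborel :: (real ^ 'd) measure).
        exp (\<i> * of_real (\<Sum>j\<in>UNIV. of_int (x $ j) * z $ j)) /
        of_real (4 * (\<Sum>j\<in>UNIV. (sin (z $ j / 2))\<^sup>2)))"

definition green :: "int ^ 'd \<Rightarrow> int ^ 'd \<Rightarrow> complex"
  where "green y x = green0 (x - y)"

text \<open>The number \<open>green0 0\<close> is real, as the integral of a real function. The dimension enters only
  through the type, hence the type argument.\<close>

definition mu :: "'d::finite itself \<Rightarrow> real"
  where "mu _ = sqrt (Re (green0 (0 :: int ^ 'd)))"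

definition green_normalized :: "int ^ 'd \<Rightarrow> int ^ 'd \<Rightarrow> complex"
  where "green_normalized y x = green y x / of_real (mu TYPE('d))"

definition weakly_sparse_via ::
  "(int ^ 'd) set \<Rightarrow> ((int ^ 'd \<Rightarrow> complex) \<Rightarrow> (int ^ 'd \<Rightarrow> complex)) \<Rightarrow> bool"
  where "weakly_sparse_via Y T \<longleftrightarrow>
     H1_bounded_operator T \<and>
     bij_betw (id_minus T) H1 H1 \<and>
     H1_bounded_operator (H1_inverse (id_minus T)) \<and>
     (let e = (\<lambda>y. H1_inverse (id_minus T) (green_normalized y)) in
       \<forall>y\<in>Y. \<forall>y'\<in>Y. energy_form (e y) (e y') = (if y = y' then 1 else 0))"

definition weakly_sparse :: "(int ^ 'd) set \<Rightarrow> bool"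
  where "weakly_sparse Y \<longleftrightarrow> (\<exists>T. weakly_sparse_via Y T)"

text \<open>Convergence of the left-hand side is part of the inequality.\<close>

definition hardy_inequality :: "(int ^ 'd \<Rightarrow> real) \<Rightarrow> real \<Rightarrow> bool"
  where "hardy_inequality W H \<longleftrightarrow>
     (\<forall>u\<in>H1. (\<lambda>x. W x * (cmod (u x))\<^sup>2) summable_on UNIV \<and>
             (\<Sum>\<^sub>\<infinity>x. W x * (cmod (u x))\<^sup>2) \<le> H * Q0 u)"

definition discrete_hardy_weight :: "(int ^ 'd \<Rightarrow> real) \<Rightarrow> bool"
  where "discrete_hardy_weight W \<longleftrightarrow> (\<forall>x. W x \<ge> 0) \<and> (\<exists>H. hardy_inequality W H)"

definition hardy_constant :: "(int ^ 'd \<Rightarrow> real) \<Rightarrow> real"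
  where "hardy_constant W = Inf {H. hardy_inequality W H}"

definition linf_norm :: "(int ^ 'd \<Rightarrow> real) \<Rightarrow> real"
  where "linf_norm W = (SUP x. \<bar>W x\<bar>)"

end

theory Submission
  imports Defs
begin

text \<open>
  The whole argument rests on the reproducing property \<open>u y = energy_form u (green y)\<close> for
  \<open>u \<in> H1\<close> (\<open>energy_form_green\<close>): the translates of the Green function represent point evaluation.

  Given it, write \<open>A = I - T\<close>, so that the normalized Green functions are \<open>A e\<^sub>y\<close> with orthonormal
  \<open>e\<^sub>y\<close>. For a finite set \<open>F\<close> of points of the support let \<open>S = (\<Sum>y\<in>F. V y * |u y|\<^sup>2)\<close> and
  \<open>w = (\<Sum>y\<in>F. V y * u y * e\<^sub>y)\<close>. By the reproducing property \<open>S = \<mu> * energy_form u (A w)\<close>, hence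
  \<open>S \<le> \<mu> * \<parallel>u\<parallel> * \<parallel>A\<parallel> * \<parallel>w\<parallel>\<close>, while orthonormality gives \<open>\<parallel>w\<parallel>\<^sup>2 \<le> \<parallel>V\<parallel> * S\<close>. Together these say
  \<open>S \<le> \<parallel>A\<parallel>\<^sup>2 * \<mu>\<^sup>2 * \<parallel>V\<parallel> * Q0 u\<close>, the upper bound. For the lower bound \<open>green y\<close> serves as a test function:
  its energy is \<open>\<mu>\<^sup>2\<close> and its value at \<open>y\<close> is \<open>\<mu>\<^sup>2\<close>, so every admissible constant is at least
  \<open>\<mu>\<^sup>2 * V y\<close>. This is stronger than the claimed bound, because \<open>A\<close>-inverse maps the unit vector
  \<open>A e\<^sub>y\<close> to the unit vector \<open>e\<^sub>y\<close> and therefore has norm at least 1.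

  The reproducing property needs that \<open>green0\<close> is in \<open>H1\<close> and is a fundamental solution of the lattice
  Laplacian. Both come from simple random walk. The Fourier multiplier of \<open>- \<Delta>\<close> is
  \<open>\<omega> = 2d * (1 - q)\<close>, where \<open>q z\<close> is the average of the \<open>cos z\<^sub>j\<close> and is the characteristic function of
  one step. So \<open>1 / \<omega>\<close> is a geometric series in \<open>q\<close>, and its partial sums are the Fourier transforms of
  the finitely supported functions \<open>walk_green n\<close>, the expected number of visits before time \<open>n\<close>
  divided by \<open>2d\<close>. Integrability of \<open>1 / \<omega>\<close> for \<open>d \<ge> 3\<close> and dominated convergence give
  \<open>walk_green n \<longlonglongrightarrow> green0\<close> pointwise, and the energy of \<open>walk_green m - walk_green n\<close> is an explicit
  second difference of the convergent sequence \<open>walk_green n 0\<close> (\<open>Q0_walk_green_diff\<close>), so the sequence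
  is Cauchy in energy.
\<close>

section \<open>The energy space\<close>

definition grad :: "(int ^ 'd \<Rightarrow> complex) \<Rightarrow> 'd \<Rightarrow> int ^ 'd \<Rightarrow> complex"
  where "grad u j x = u (x + axis j 1) - u x"

definition energy_density :: "(int ^ 'd \<Rightarrow> complex) \<Rightarrow> int ^ 'd \<Rightarrow> real"
  where "energy_density u x = (\<Sum>j\<in>UNIV. (cmod (grad u j x))\<^sup>2)"

definition finite_energy :: "(int ^ 'd \<Rightarrow> complex) \<Rightarrow> bool"
  where "finite_energy u \<longleftrightarrow> energy_density u summable_on UNIV"

lemma Q0_eq: "Q0 u = (\<Sum>\<^sub>\<infinity>x. energy_density u x)"
  by (simp add: Q0_def energy_density_def grad_def)

lemma energy_form_eq:
  "energy_form u v = (\<Sum>\<^sub>\<infinity>x. \<Sum>j\<in>UNIV. grad u j x * cnj (grad v j x))"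
  by (simp add: energy_form_def grad_def)

lemma grad_add: "grad (\<lambda>x. u x + v x) j x = grad u j x + grad v j x"
  by (simp add: grad_def)

lemma grad_cmult: "grad (\<lambda>x. c * u x) j x = c * grad u j x"
  by (simp add: grad_def algebra_simps)

lemma energy_density_nonneg [simp]: "energy_density u x \<ge> 0"
  by (simp add: energy_density_def sum_nonneg)

lemma Q0_nonneg [simp]: "Q0 u \<ge> 0"
  by (simp add: Q0_eq infsum_nonneg)

lemma H1_norm_nonneg [simp]: "H1_norm u \<ge> 0"
  by (simp add: H1_norm_def)

lemma H1_norm_squared: "(H1_norm u)\<^sup>2 = Q0 u"
  by (simp add: H1_norm_def)

lemma finite_energyI:
  assumes "\<And>F. finite F \<Longrightarrow> (\<Sum>x\<in>F. energy_density u x) \<le> B"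
  shows "finite_energy u" and "Q0 u \<le> B"
proof -
  show *: "finite_energy u" unfolding finite_energy_def
    by (rule nonneg_bdd_above_summable_on) (auto simp: bdd_above_def intro!: exI[of _ B] assms)
  then show "Q0 u \<le> B" unfolding Q0_eq finite_energy_def
    by (rule infsum_le_finite_sums) (auto intro: assms)
qed

lemma sum_energy_density_le_Q0:
  assumes "finite_energy u" "finite F"
  shows "(\<Sum>x\<in>F. energy_density u x) \<le> Q0 u"
  using assms unfolding Q0_eq finite_energy_def by (intro finite_sum_le_infsum) auto

lemma finite_energy_finite_support:
  assumes "finite {x. u x \<noteq> 0}"
  shows "finite_energy u"
proof -
  have "{x. energy_density u x \<noteq> 0} \<subseteq> {x. u x \<noteq> 0} \<union> (\<Union>j. (\<lambda>x. x - axis j 1) ` {x. u x \<noteq> 0})"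
  proof
    fix x assume "x \<in> {x. energy_density u x \<noteq> 0}"
    then have "\<exists>j. grad u j x \<noteq> 0"
      using sum.not_neutral_contains_not_neutral[of "\<lambda>j. (cmod (grad u j x))\<^sup>2"]
      by (auto simp: energy_density_def)
    then obtain j where "grad u j x \<noteq> 0" ..
    then have "u x \<noteq> 0 \<or> u (x + axis j 1) \<noteq> 0" by (auto simp: grad_def)
    then show "x \<in> {x. u x \<noteq> 0} \<union> (\<Union>j. (\<lambda>x. x - axis j 1) ` {x. u x \<noteq> 0})"
      by (auto simp: image_iff intro!: exI[of _ j] exI[of _ "x + axis j 1"])
  qed
  then have "finite {x. energy_density u x \<noteq> 0}"
    by (rule finite_subset) (auto simp: assms)
  then show ?thesis
    unfolding finite_energy_def by (intro finite_nonzero_values_imp_summable_on) simp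
qed

lemma finite_energy_cmult:
  assumes "finite_energy u" shows "finite_energy (\<lambda>x. c * u x)"
proof -
  have "energy_density (\<lambda>x. c * u x) = (\<lambda>x. (cmod c)\<^sup>2 * energy_density u x)"
    by (auto simp: energy_density_def grad_cmult norm_mult power_mult_distrib sum_distrib_left)
  then show ?thesis using assms unfolding finite_energy_def by (simp add: summable_on_cmult_right)
qed

lemma H1_norm_cmult: "H1_norm (\<lambda>x. c * u x) = cmod c * H1_norm u"
proof -
  have "energy_density (\<lambda>x. c * u x) = (\<lambda>x. (cmod c)\<^sup>2 * energy_density u x)"
    by (auto simp: energy_density_def grad_cmult norm_mult power_mult_distrib sum_distrib_left)
  then have "Q0 (\<lambda>x. c * u x) = (cmod c)\<^sup>2 * Q0 u"
    by (simp add: Q0_eq infsum_cmult_right')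
  then show ?thesis by (simp add: H1_norm_def real_sqrt_mult)
qed

lemma H1_norm_minus_commute: "H1_norm (\<lambda>x. u x - v x) = H1_norm (\<lambda>x. v x - u x)"
  using H1_norm_cmult[of "-1" "\<lambda>x. u x - v x"] by simp

lemma finite_energy_add:
  assumes "finite_energy u" "finite_energy v"
  shows "finite_energy (\<lambda>x. u x + v x)"
proof -
  have "(\<lambda>x. 2 * energy_density u x + 2 * energy_density v x) summable_on UNIV"
    using assms unfolding finite_energy_def
    by (intro summable_on_add summable_on_cmult_right)
  then show ?thesis unfolding finite_energy_def
  proof (rule summable_on_comparison_test)
    fix x
    have "(cmod (a + b))\<^sup>2 \<le> 2 * (cmod a)\<^sup>2 + 2 * (cmod b)\<^sup>2" for a b :: complex
    proof -
      have "(cmod (a + b))\<^sup>2 \<le> (cmod a + cmod b)\<^sup>2"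
        by (intro power_mono norm_triangle_ineq) simp
      also have "\<dots> \<le> 2 * (cmod a)\<^sup>2 + 2 * (cmod b)\<^sup>2"
        using sum_squares_bound[of "cmod a" "cmod b"] by (simp add: power2_sum)
      finally show ?thesis .
    qed
    then show "energy_density (\<lambda>x. u x + v x) x \<le> 2 * energy_density u x + 2 * energy_density v x"
      unfolding energy_density_def grad_add sum_distrib_left sum.distrib[symmetric]
      by (intro sum_mono)
  qed auto
qed

lemma finite_energy_diff:
  assumes "finite_energy u" "finite_energy v"
  shows "finite_energy (\<lambda>x. u x - v x)"
  using finite_energy_add[OF assms(1) finite_energy_cmult[OF assms(2), of "-1"]] by simp

text \<open>
  The weighted arithmetic-geometric mean inequality with a free parameter \<open>t\<close>. It survives summation,
  so it yields both the convergence of \<open>energy_form\<close> and, after optimizing \<open>t\<close>, the Cauchy-Schwarz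
  inequality.
\<close>

lemma norm_energy_integrand_le:
  assumes "t > 0"
  shows "cmod (\<Sum>j\<in>UNIV. grad u j x * cnj (grad v j x))
    \<le> (t / 2) * energy_density u x + (1 / (2 * t)) * energy_density v x"
proof -
  have "cmod (\<Sum>j\<in>UNIV. grad u j x * cnj (grad v j x))
      \<le> (\<Sum>j\<in>UNIV. cmod (grad u j x) * cmod (grad v j x))"
    by (rule order_trans[OF norm_sum]) (simp add: norm_mult)
  also have "\<dots> \<le> (\<Sum>j\<in>UNIV. (t / 2) * (cmod (grad u j x))\<^sup>2
                              + (1 / (2 * t)) * (cmod (grad v j x))\<^sup>2)"
  proof (rule sum_mono)
    fix j
    have "0 \<le> (t * cmod (grad u j x) - cmod (grad v j x))\<^sup>2 / (2 * t)" using assms by simp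
    also have "\<dots> = (t / 2) * (cmod (grad u j x))\<^sup>2 + (1 / (2 * t)) * (cmod (grad v j x))\<^sup>2
                 - cmod (grad u j x) * cmod (grad v j x)"
      using assms by (simp add: power2_diff field_simps power2_eq_square)
    finally show "cmod (grad u j x) * cmod (grad v j x)
      \<le> (t / 2) * (cmod (grad u j x))\<^sup>2 + (1 / (2 * t)) * (cmod (grad v j x))\<^sup>2" by simp
  qed
  also have "\<dots> = (t / 2) * energy_density u x + (1 / (2 * t)) * energy_density v x"
    by (simp add: energy_density_def sum.distrib sum_distrib_left)
  finally show ?thesis .
qed

lemma
  assumes "finite_energy u" "finite_energy v"
  shows energy_form_summable:
      "(\<lambda>x. \<Sum>j\<in>UNIV. grad u j x * cnj (grad v j x)) summable_on UNIV"
    and norm_energy_form_le: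
      "t > 0 \<Longrightarrow> cmod (energy_form u v) \<le> (t / 2) * Q0 u + (1 / (2 * t)) * Q0 v"
proof -
  let ?f = "\<lambda>x. \<Sum>j\<in>UNIV. grad u j x * cnj (grad v j x)"
  have s: "(\<lambda>x. (t / 2) * energy_density u x + (1 / (2 * t)) * energy_density v x) summable_on UNIV"
    for t :: real
    using assms unfolding finite_energy_def
    by (intro summable_on_add summable_on_cmult_right)
  have abs: "(\<lambda>x. cmod (?f x)) summable_on UNIV"
    by (rule summable_on_comparison_test[OF s[of 1]]) (use norm_energy_integrand_le[of 1] in auto)
  then show "?f summable_on UNIV" by (rule abs_summable_summable)
  assume t: "t > 0"
  have "cmod (energy_form u v) \<le> (\<Sum>\<^sub>\<infinity>x. cmod (?f x))"
    unfolding energy_form_eq by (rule norm_infsum_bound[OF abs])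
  also have "\<dots> \<le> (\<Sum>\<^sub>\<infinity>x. (t / 2) * energy_density u x + (1 / (2 * t)) * energy_density v x)"
    by (rule infsum_mono[OF abs s norm_energy_integrand_le[OF t]])
  also have "\<dots> = (t / 2) * Q0 u + (1 / (2 * t)) * Q0 v"
    using assms unfolding finite_energy_def
    by (subst infsum_add[OF summable_on_cmult_right summable_on_cmult_right])
       (simp_all only: infsum_cmult_right' Q0_eq)
  finally show "cmod (energy_form u v) \<le> (t / 2) * Q0 u + (1 / (2 * t)) * Q0 v" .
qed

lemma energy_form_Cauchy_Schwarz:
  assumes "finite_energy u" "finite_energy v"
  shows "cmod (energy_form u v) \<le> H1_norm u * H1_norm v"
proof (rule field_le_epsilon)
  fix e :: real assume e: "e > 0"
  define a where "a = H1_norm u"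
  define b where "b = H1_norm v"
  have ab: "a \<ge> 0" "b \<ge> 0" by (simp_all add: a_def b_def)
  \<comment> \<open>The optimal \<open>t\<close> is \<open>b / a\<close>; adding \<open>d\<close> to both norms covers the case that one of them is zero.\<close>
  define d where "d = 2 * e / (a + b + 1)"
  have d: "d > 0" using e ab by (simp add: d_def)
  define t where "t = (b + d) / (a + d)"
  have t: "t > 0" using ab d by (simp add: t_def)
  have "cmod (energy_form u v) \<le> (t / 2) * a\<^sup>2 + (1 / (2 * t)) * b\<^sup>2"
    using norm_energy_form_le[OF assms t] by (simp add: a_def b_def H1_norm_squared)
  also have "(t / 2) * a\<^sup>2 \<le> (b + d) * a / 2"
  proof -
    have "(t / 2) * a\<^sup>2 = (b + d) * a / 2 * (a / (a + d))"
      using ab d by (simp add: t_def power2_eq_square field_simps)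
    also have "\<dots> \<le> (b + d) * a / 2 * 1"
      using ab d by (intro mult_left_mono) (auto simp: divide_le_eq)
    finally show ?thesis by simp
  qed
  also have "(1 / (2 * t)) * b\<^sup>2 \<le> (a + d) * b / 2"
  proof -
    have "(1 / (2 * t)) * b\<^sup>2 = (a + d) * b / 2 * (b / (b + d))"
      using ab d by (simp add: t_def power2_eq_square field_simps)
    also have "\<dots> \<le> (a + d) * b / 2 * 1"
      using ab d by (intro mult_left_mono) (auto simp: divide_le_eq)
    finally show ?thesis by simp
  qed
  also have "(b + d) * a / 2 + (a + d) * b / 2 = a * b + d * (a + b) / 2"
    by (simp add: field_simps)
  also have "d * (a + b) / 2 \<le> e"
    using ab e by (simp add: d_def field_simps)
  finally show "cmod (energy_form u v) \<le> H1_norm u * H1_norm v + e" by (simp add: a_def b_def)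
qed

lemma energy_form_cnj: "energy_form v u = cnj (energy_form u v)"
  unfolding energy_form_eq by (subst infsum_cnj[symmetric]) (simp add: mult.commute)

lemma energy_form_self:
  assumes "finite_energy u"
  shows "energy_form u u = of_real (Q0 u)"
proof -
  have "energy_form u u = (\<Sum>\<^sub>\<infinity>x. of_real (energy_density u x))"
    unfolding energy_form_eq energy_density_def
    by (simp add: complex_norm_square[symmetric])
  also have "\<dots> = of_real (Q0 u)"
    using assms unfolding Q0_eq finite_energy_def by (intro infsumI has_sum_of_real has_sum_infsum)
  finally show ?thesis .
qed

lemma energy_form_add_left:
  assumes "finite_energy u" "finite_energy v" "finite_energy w"
  shows "energy_form (\<lambda>x. u x + v x) w = energy_form u w + energy_form v w"
  unfolding energy_form_eq
  by (subst infsum_add[symmetric])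
     (auto simp: energy_form_summable assms grad_add algebra_simps sum.distrib)

lemma energy_form_add_right:
  assumes "finite_energy u" "finite_energy v" "finite_energy w"
  shows "energy_form w (\<lambda>x. u x + v x) = energy_form w u + energy_form w v"
  by (subst energy_form_cnj, subst energy_form_add_left[OF assms])
     (simp add: energy_form_cnj[symmetric])

lemma energy_form_cmult_left: "energy_form (\<lambda>x. c * u x) w = c * energy_form u w"
  unfolding energy_form_eq
  by (subst infsum_cmult_right'[symmetric]) (simp add: grad_cmult mult.assoc sum_distrib_left)

lemma energy_form_diff_left:
  assumes "finite_energy u" "finite_energy v" "finite_energy w"
  shows "energy_form (\<lambda>x. u x - v x) w = energy_form u w - energy_form v w"
  using energy_form_add_left[OF assms(1) finite_energy_cmult[OF assms(2), of "-1"] assms(3)]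
    energy_form_cmult_left[of "-1" v w] by simp

lemma finite_energy_zero: "finite_energy (\<lambda>x. 0)"
  by (simp add: finite_energy_finite_support)

lemma finite_energy_sum:
  assumes "finite F" "\<And>i. i \<in> F \<Longrightarrow> finite_energy (f i)"
  shows "finite_energy (\<lambda>x. \<Sum>i\<in>F. c i * f i x)"
  using assms by (induction F) (simp_all add: finite_energy_add finite_energy_cmult finite_energy_zero)

lemma energy_form_sum_left:
  assumes "finite F" "\<And>i. i \<in> F \<Longrightarrow> finite_energy (f i)" "finite_energy v"
  shows "energy_form (\<lambda>x. \<Sum>i\<in>F. c i * f i x) v = (\<Sum>i\<in>F. c i * energy_form (f i) v)"
  using assms
proof (induction F)
  case empty
  show ?case by (simp add: energy_form_def)
next
  case (insert i F)
  then show ?case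
    by (simp add: energy_form_add_left finite_energy_cmult finite_energy_sum energy_form_cmult_left)
qed

lemma energy_form_sum_right:
  assumes "finite F" "\<And>i. i \<in> F \<Longrightarrow> finite_energy (f i)" "finite_energy v"
  shows "energy_form v (\<lambda>x. \<Sum>i\<in>F. c i * f i x) = (\<Sum>i\<in>F. cnj (c i) * energy_form v (f i))"
proof -
  have "energy_form v (\<lambda>x. \<Sum>i\<in>F. c i * f i x) = cnj (\<Sum>i\<in>F. c i * energy_form (f i) v)"
    by (subst energy_form_cnj) (simp only: energy_form_sum_left[OF assms])
  also have "\<dots> = (\<Sum>i\<in>F. cnj (c i) * cnj (energy_form (f i) v))" by simp
  also have "\<dots> = (\<Sum>i\<in>F. cnj (c i) * energy_form v (f i))"
    by (intro sum.cong refl arg_cong2[where f = "(*)"] energy_form_cnj[symmetric])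
  finally show ?thesis .
qed

lemma H1_norm_triangle:
  assumes "finite_energy u" "finite_energy v"
  shows "H1_norm (\<lambda>x. u x + v x) \<le> H1_norm u + H1_norm v"
proof (rule power2_le_imp_le)
  let ?s = "\<lambda>x. u x + v x"
  have fs: "finite_energy ?s" by (rule finite_energy_add[OF assms])
  have e: "energy_form ?s ?s = energy_form u u + energy_form u v + (energy_form v u + energy_form v v)"
    by (simp add: energy_form_add_left energy_form_add_right assms fs)
  have "Q0 ?s = Re (energy_form ?s ?s)" by (simp add: energy_form_self[OF fs])
  also have "\<dots> = Q0 u + 2 * Re (energy_form u v) + Q0 v"
    by (simp add: e energy_form_self assms energy_form_cnj[of v u])
  also have "Re (energy_form u v) \<le> H1_norm u * H1_norm v"
    using complex_Re_le_cmod energy_form_Cauchy_Schwarz[OF assms] by (rule order_trans)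
  also have "Q0 u + 2 * (H1_norm u * H1_norm v) + Q0 v = (H1_norm u + H1_norm v)\<^sup>2"
    by (simp add: power2_sum H1_norm_squared)
  finally show "(H1_norm ?s)\<^sup>2 \<le> (H1_norm u + H1_norm v)\<^sup>2" by (simp add: H1_norm_squared)
qed simp

lemma H1_norm_triangle_diff:
  assumes "finite_energy u" "finite_energy v" "finite_energy w"
  shows "H1_norm (\<lambda>x. u x - w x) \<le> H1_norm (\<lambda>x. u x - v x) + H1_norm (\<lambda>x. v x - w x)"
  using H1_norm_triangle[of "\<lambda>x. u x - v x" "\<lambda>x. v x - w x"] assms
  by (simp add: finite_energy_diff)

lemma has_sum_finite_sum:
  fixes f :: "'i \<Rightarrow> 'a \<Rightarrow> 'b::topological_comm_monoid_add"
  assumes "finite I" "\<And>i. i \<in> I \<Longrightarrow> (f i has_sum s i) A"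
  shows "((\<lambda>x. \<Sum>i\<in>I. f i x) has_sum (\<Sum>i\<in>I. s i)) A"
  using assms by (induction I) (simp_all add: has_sum_add)

text \<open>
  Lower semicontinuity of the energy under pointwise convergence: a bound on the energy is a bound on all
  its finite partial sums, and each of these is continuous in finitely many values. This replaces an
  abstract completion: it shows that a limit function of a Cauchy sequence has finite energy and is also
  its limit in energy.
\<close>

lemma H1_norm_pointwise_limit_le:
  assumes lim: "\<And>x. (\<lambda>n. f n x) \<longlonglongrightarrow> g x"
    and fe: "\<And>n. finite_energy (f n)"
    and le: "\<forall>\<^sub>F n in sequentially. H1_norm (f n) \<le> B"
  shows "finite_energy g" and "H1_norm g \<le> B"
proof -
  from le have B: "B \<ge> 0"
    by (auto simp: eventually_sequentially intro: order_trans[OF H1_norm_nonneg])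
  have *: "(\<Sum>x\<in>F. energy_density g x) \<le> B\<^sup>2" if F: "finite F" for F
  proof (rule tendsto_upperbound)
    show "(\<lambda>n. \<Sum>x\<in>F. energy_density (f n) x) \<longlonglongrightarrow> (\<Sum>x\<in>F. energy_density g x)"
      unfolding energy_density_def grad_def by (intro tendsto_intros lim)
    show "\<forall>\<^sub>F n in sequentially. (\<Sum>x\<in>F. energy_density (f n) x) \<le> B\<^sup>2"
      using le
    proof eventually_elim
      case (elim n)
      have "(\<Sum>x\<in>F. energy_density (f n) x) \<le> (H1_norm (f n))\<^sup>2"
        unfolding H1_norm_squared by (rule sum_energy_density_le_Q0[OF fe F])
      also have "\<dots> \<le> B\<^sup>2" using elim by (intro power_mono) auto
      finally show ?case .
    qed
  qed simp
  show "finite_energy g" by (rule finite_energyI[OF *])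
  have "Q0 g \<le> B\<^sup>2" by (rule finite_energyI[OF *])
  then show "H1_norm g \<le> B" unfolding H1_norm_def using B real_le_lsqrt by blast
qed

lemma H1_finite_energy_approx:
  assumes "\<And>n. finite {x. \<phi> n x \<noteq> 0}"
    and "\<forall>\<epsilon>>0. \<exists>N. \<forall>m\<ge>N. \<forall>n\<ge>N. H1_norm (\<lambda>x. \<phi> m x - \<phi> n x) < \<epsilon>"
    and lim: "\<And>x. (\<lambda>n. \<phi> n x) \<longlonglongrightarrow> u x"
  shows "finite_energy u" and "(\<lambda>n. H1_norm (\<lambda>x. \<phi> n x - u x)) \<longlonglongrightarrow> 0"
proof -
  have fe: "finite_energy (\<phi> n)" for n by (intro finite_energy_finite_support assms)
  have key: "\<exists>N. \<forall>n\<ge>N. finite_energy (\<lambda>x. \<phi> n x - u x) \<and> H1_norm (\<lambda>x. \<phi> n x - u x) \<le> \<epsilon>"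
    if "\<epsilon> > 0" for \<epsilon>
  proof -
    from assms(2) that obtain N
      where N: "\<And>m n. m \<ge> N \<Longrightarrow> n \<ge> N \<Longrightarrow> H1_norm (\<lambda>x. \<phi> m x - \<phi> n x) < \<epsilon>" by blast
    have "finite_energy (\<lambda>x. \<phi> n x - u x) \<and> H1_norm (\<lambda>x. \<phi> n x - u x) \<le> \<epsilon>" if n: "n \<ge> N" for n
    proof -
      have l: "(\<lambda>m. \<phi> n x - \<phi> m x) \<longlonglongrightarrow> \<phi> n x - u x" for x by (intro tendsto_intros lim)
      have f: "finite_energy (\<lambda>x. \<phi> n x - \<phi> m x)" for m by (intro finite_energy_diff fe)
      have b: "\<forall>\<^sub>F m in sequentially. H1_norm (\<lambda>x. \<phi> n x - \<phi> m x) \<le> \<epsilon>"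
        unfolding eventually_sequentially using N n by (intro exI[of _ N]) (auto intro: less_imp_le)
      show ?thesis using H1_norm_pointwise_limit_le[OF l f b] by blast
    qed
    then show ?thesis by blast
  qed
  from key[of 1] obtain n where n: "finite_energy (\<lambda>x. \<phi> n x - u x)" by auto
  show "finite_energy u" using finite_energy_diff[OF fe[of n] n] by simp
  show "(\<lambda>n. H1_norm (\<lambda>x. \<phi> n x - u x)) \<longlonglongrightarrow> 0"
  proof (rule LIMSEQ_I)
    fix r :: real assume "r > 0"
    then have "r / 2 > 0" by simp
    from key[OF this] obtain N where "\<forall>n\<ge>N. H1_norm (\<lambda>x. \<phi> n x - u x) \<le> r / 2" by blast
    then have "\<forall>n\<ge>N. norm (H1_norm (\<lambda>x. \<phi> n x - u x) - 0) < r" using \<open>r > 0\<close> by fastforce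
    then show "\<exists>N. \<forall>n\<ge>N. norm (H1_norm (\<lambda>x. \<phi> n x - u x) - 0) < r" by blast
  qed
qed

lemma H1_finite_energy: "u \<in> H1 \<Longrightarrow> finite_energy u"
  unfolding H1_def using H1_finite_energy_approx(1) by blast

lemma H1E:
  assumes "u \<in> H1"
  obtains \<phi> where "\<And>n. finite {x. \<phi> n x \<noteq> 0}" "\<And>x. (\<lambda>n. \<phi> n x) \<longlonglongrightarrow> u x"
    "(\<lambda>n. H1_norm (\<lambda>x. \<phi> n x - u x)) \<longlonglongrightarrow> 0"
proof -
  from assms obtain \<phi> where \<phi>: "\<And>n. finite {x. \<phi> n x \<noteq> 0}" "\<And>x. (\<lambda>n. \<phi> n x) \<longlonglongrightarrow> u x"
    "\<forall>\<epsilon>>0. \<exists>N. \<forall>m\<ge>N. \<forall>n\<ge>N. H1_norm (\<lambda>x. \<phi> m x - \<phi> n x) < \<epsilon>"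
    unfolding H1_def by blast
  show ?thesis by (rule that[OF \<phi>(1,2) H1_finite_energy_approx(2)[OF \<phi>(1,3,2)]])
qed

text \<open>
  Unlike the defining property of \<open>H1\<close>, which speaks only of pairs of approximants, the criterion
  refers to convergence in energy to the limit itself; this form is additive.
\<close>

lemma H1I:
  assumes fin: "\<And>n. finite {x. \<phi> n x \<noteq> 0}" and lim: "\<And>x. (\<lambda>n. \<phi> n x) \<longlonglongrightarrow> u x"
    and fe: "finite_energy u" and conv: "(\<lambda>n. H1_norm (\<lambda>x. \<phi> n x - u x)) \<longlonglongrightarrow> 0"
  shows "u \<in> H1"
  unfolding H1_def mem_Collect_eq
proof (intro exI[of _ \<phi>] conjI allI impI fin lim)
  fix e :: real assume "e > 0"
  then have "e / 2 > 0" by simp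
  from order_tendstoD(2)[OF conv this] obtain N
    where N: "\<And>n. n \<ge> N \<Longrightarrow> H1_norm (\<lambda>x. \<phi> n x - u x) < e / 2"
    unfolding eventually_sequentially by blast
  have "H1_norm (\<lambda>x. \<phi> m x - \<phi> n x) < e" if "m \<ge> N" "n \<ge> N" for m n
  proof -
    have "H1_norm (\<lambda>x. \<phi> m x - \<phi> n x)
        \<le> H1_norm (\<lambda>x. \<phi> m x - u x) + H1_norm (\<lambda>x. u x - \<phi> n x)"
      by (intro H1_norm_triangle_diff finite_energy_finite_support fin fe)
    then show ?thesis using N[OF that(1)] N[OF that(2)] H1_norm_minus_commute[of u "\<phi> n"] by simp
  qed
  then show "\<exists>N. \<forall>m\<ge>N. \<forall>n\<ge>N. H1_norm (\<lambda>x. \<phi> m x - \<phi> n x) < e" by blast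
qed

lemma H1_finite_support: "finite {x. u x \<noteq> 0} \<Longrightarrow> u \<in> H1"
  by (rule H1I[of "\<lambda>n. u"]) (auto simp: finite_energy_finite_support H1_norm_def Q0_def)

lemma H1_cmult:
  assumes "u \<in> H1" shows "(\<lambda>x. c * u x) \<in> H1"
proof -
  from H1E[OF assms] obtain \<phi> where \<phi>: "\<And>n. finite {x. \<phi> n x \<noteq> 0}" "\<And>x. (\<lambda>n. \<phi> n x) \<longlonglongrightarrow> u x"
    "(\<lambda>n. H1_norm (\<lambda>x. \<phi> n x - u x)) \<longlonglongrightarrow> 0" by blast
  have "(\<lambda>n. cmod c * H1_norm (\<lambda>x. \<phi> n x - u x)) \<longlonglongrightarrow> 0"
    using tendsto_mult_left[OF \<phi>(3), of "cmod c"] by simp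
  then have "(\<lambda>n. H1_norm (\<lambda>x. c * \<phi> n x - c * u x)) \<longlonglongrightarrow> 0"
    by (simp flip: H1_norm_cmult right_diff_distrib)
  then show ?thesis
  proof (rule H1I[rotated -1])
    show "finite {x. c * \<phi> n x \<noteq> 0}" for n by (rule finite_subset[OF _ \<phi>(1)[of n]]) auto
    show "finite_energy (\<lambda>x. c * u x)"
      by (intro finite_energy_cmult H1_finite_energy assms)
  qed (intro tendsto_intros \<phi>)
qed

lemma H1_add:
  assumes "u \<in> H1" "v \<in> H1" shows "(\<lambda>x. u x + v x) \<in> H1"
proof -
  from H1E[OF assms(1)] obtain \<phi> where \<phi>: "\<And>n. finite {x. \<phi> n x \<noteq> 0}"
    "\<And>x. (\<lambda>n. \<phi> n x) \<longlonglongrightarrow> u x" "(\<lambda>n. H1_norm (\<lambda>x. \<phi> n x - u x)) \<longlonglongrightarrow> 0" by blast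
  from H1E[OF assms(2)] obtain \<psi> where \<psi>: "\<And>n. finite {x. \<psi> n x \<noteq> 0}"
    "\<And>x. (\<lambda>n. \<psi> n x) \<longlonglongrightarrow> v x" "(\<lambda>n. H1_norm (\<lambda>x. \<psi> n x - v x)) \<longlonglongrightarrow> 0" by blast
  note fe = finite_energy_finite_support[OF \<phi>(1)] finite_energy_finite_support[OF \<psi>(1)]
    H1_finite_energy[OF assms(1)] H1_finite_energy[OF assms(2)]
  have le: "H1_norm (\<lambda>x. (\<phi> n x + \<psi> n x) - (u x + v x))
      \<le> H1_norm (\<lambda>x. \<phi> n x - u x) + H1_norm (\<lambda>x. \<psi> n x - v x)" for n
    using H1_norm_triangle[of "\<lambda>x. \<phi> n x - u x" "\<lambda>x. \<psi> n x - v x"] fe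
    by (simp add: finite_energy_diff add_diff_add)
  have "(\<lambda>n. H1_norm (\<lambda>x. \<phi> n x - u x) + H1_norm (\<lambda>x. \<psi> n x - v x)) \<longlonglongrightarrow> 0"
    using tendsto_add[OF \<phi>(3) \<psi>(3)] by simp
  then have "(\<lambda>n. H1_norm (\<lambda>x. (\<phi> n x + \<psi> n x) - (u x + v x))) \<longlonglongrightarrow> 0"
    by (rule tendsto_sandwich[OF _ _ tendsto_const, rotated 2]) (use le in auto)
  then show ?thesis
  proof (rule H1I[rotated -1])
    show "finite {x. \<phi> n x + \<psi> n x \<noteq> 0}" for n
      by (rule finite_subset[OF _ finite_UnI[OF \<phi>(1)[of n] \<psi>(1)[of n]]]) auto
  qed (auto intro!: tendsto_intros \<phi> \<psi> finite_energy_add fe)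
qed

lemma H1_zero: "(\<lambda>x. 0) \<in> H1"
  by (simp add: H1_finite_support)

lemma H1_diff: "u \<in> H1 \<Longrightarrow> v \<in> H1 \<Longrightarrow> (\<lambda>x. u x - v x) \<in> H1"
  using H1_add[OF _ H1_cmult[of v "-1"]] by simp

lemma H1_sum:
  assumes "finite F" "\<And>i. i \<in> F \<Longrightarrow> f i \<in> H1"
  shows "(\<lambda>x. \<Sum>i\<in>F. c i * f i x) \<in> H1"
  using assms by (induction F) (simp_all add: H1_add H1_cmult H1_zero)

lemma H1_energy_form_limit:
  assumes "finite_energy u" "finite_energy v" "\<And>n. finite_energy (\<phi> n)"
    "(\<lambda>n. H1_norm (\<lambda>x. \<phi> n x - u x)) \<longlonglongrightarrow> 0"
  shows "(\<lambda>n. energy_form (\<phi> n) v) \<longlonglongrightarrow> energy_form u v"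
proof (rule LIM_zero_cancel, rule Lim_null_comparison)
  show "\<forall>\<^sub>F n in sequentially. norm (energy_form (\<phi> n) v - energy_form u v)
      \<le> H1_norm (\<lambda>x. \<phi> n x - u x) * H1_norm v"
    using energy_form_Cauchy_Schwarz[of "\<lambda>x. \<phi> _ x - u x" v] assms
    by (simp add: energy_form_diff_left finite_energy_diff)
  show "(\<lambda>n. H1_norm (\<lambda>x. \<phi> n x - u x) * H1_norm v) \<longlonglongrightarrow> 0"
    using tendsto_mult_right[OF assms(4)] by simp
qed

text \<open>
  The positive operator \<open>- \<Delta>\<close>, for which \<open>energy_form u v\<close> is the pairing of \<open>u\<close> with
  \<open>neg_laplacian v\<close>.
\<close>

definition neg_laplacian :: "(int ^ 'd \<Rightarrow> complex) \<Rightarrow> int ^ 'd \<Rightarrow> complex"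
  where "neg_laplacian v x = (\<Sum>j\<in>UNIV. 2 * v x - v (x + axis j 1) - v (x - axis j 1))"

text \<open>
  Summation by parts. Finite support of one argument removes all questions of convergence, so that the
  other one is arbitrary.
\<close>

lemma energy_form_by_parts:
  fixes u v :: "int ^ 'd \<Rightarrow> complex"
  assumes fin: "finite {x. u x \<noteq> 0}"
  shows "energy_form u v = (\<Sum>x | u x \<noteq> 0. u x * cnj (neg_laplacian v x))"
proof -
  define S where "S = {x. u x \<noteq> 0}"
  have S: "finite S" using fin by (simp add: S_def)
  have hs: "((\<lambda>x. u (x + a) * w x) has_sum (\<Sum>x\<in>S. u x * w (x - a))) UNIV" for a w
  proof -
    have "((\<lambda>x. u x * w (x - a)) has_sum (\<Sum>x\<in>S. u x * w (x - a))) S"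
      using S by (simp add: has_sum_finite)
    then have "((\<lambda>x. u x * w (x - a)) has_sum (\<Sum>x\<in>S. u x * w (x - a))) UNIV"
      by (rule iffD1[OF has_sum_cong_neutral, rotated -1]) (auto simp: S_def)
    moreover have "bij_betw (\<lambda>x. x + a) UNIV UNIV"
      by (rule bij_betw_byWitness[of _ "\<lambda>x. x - a"]) auto
    ultimately show ?thesis
      using has_sum_reindex_bij_betw[of "\<lambda>x. x + a" UNIV UNIV "\<lambda>x. u x * w (x - a)"] by simp
  qed
  have "((\<lambda>x. grad u j x * cnj (grad v j x)) has_sum
      (\<Sum>x\<in>S. u x * cnj (2 * v x - v (x + axis j 1) - v (x - axis j 1)))) UNIV" for j
    using has_sum_add[OF hs[of "axis j 1" "\<lambda>x. cnj (grad v j x)"]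
        hs[of 0 "\<lambda>x. - cnj (grad v j x)"]]
    by (simp add: grad_def algebra_simps sum.distrib[symmetric])
  then have "((\<lambda>x. \<Sum>j\<in>UNIV. grad u j x * cnj (grad v j x)) has_sum
      (\<Sum>j\<in>UNIV. \<Sum>x\<in>S. u x * cnj (2 * v x - v (x + axis j 1) - v (x - axis j 1)))) UNIV"
    by (intro has_sum_finite_sum) auto
  then have "energy_form u v
      = (\<Sum>j\<in>UNIV. \<Sum>x\<in>S. u x * cnj (2 * v x - v (x + axis j 1) - v (x - axis j 1)))"
    unfolding energy_form_eq by (rule infsumI)
  also have "\<dots> = (\<Sum>x\<in>S. u x * cnj (neg_laplacian v x))"
    unfolding neg_laplacian_def by (subst sum.swap) (simp add: sum_distrib_left)
  finally show ?thesis by (simp add: S_def)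
qed

section \<open>Random walk and the Green function in Fourier space\<close>

lemma Basis_vec_eq_range_axis: "(Basis :: (real ^ 'd) set) = range (\<lambda>j. axis j 1)"
  by (auto simp: Basis_vec_def)

text \<open>
  Fubini for products of functions of one coordinate. It is used both for the orthogonality of characters
  and for the integrability of the product majorant of the inverse symbol.
\<close>

lemma lborel_vec_product:
  fixes f :: "'d::finite \<Rightarrow> real \<Rightarrow> 'a::{real_normed_field,banach,second_countable_topology}"
  assumes f: "\<And>j. integrable lborel (f j)"
  shows integrable_lborel_vec_prod: "integrable lborel (\<lambda>z :: real ^ 'd. \<Prod>j\<in>UNIV. f j (z $ j))"
    and integral_lborel_vec_prod:
      "(LINT z | lborel. (\<Prod>j\<in>UNIV. f j ((z :: real ^ 'd) $ j))) = (\<Prod>j\<in>UNIV. integral\<^sup>L lborel (f j))"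
proof -
  interpret product_sigma_finite "\<lambda>_ :: real ^ 'd. lborel :: real measure" ..
  define idx :: "real ^ 'd \<Rightarrow> 'd" where "idx = inv (\<lambda>j. axis j 1)"
  have inj: "inj (\<lambda>j :: 'd. axis j (1 :: real))" by (auto simp: inj_def axis_eq_axis)
  have idx: "idx (axis j 1) = j" for j unfolding idx_def by (rule inv_f_f[OF inj])
  have meas [measurable]: "f j \<in> borel_measurable borel" for j
    using borel_measurable_integrable[OF f[of j]] by simp
  have reindex: "(\<Prod>j\<in>UNIV. h j (axis j 1)) = (\<Prod>b\<in>Basis. h (idx b) b)"
    for h :: "'d \<Rightarrow> real ^ 'd \<Rightarrow> 'a"
    unfolding Basis_vec_eq_range_axis by (subst prod.reindex[OF inj]) (simp add: idx)
  have eq: "(\<Prod>j\<in>UNIV. f j (z $ j)) = (\<Prod>b\<in>Basis. f (idx b) (z \<bullet> b))" for z :: "real ^ 'd"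
    using reindex[of "\<lambda>j b. f j (z \<bullet> b)"] by (simp add: inner_axis)
  have emb [measurable]: "(\<lambda>g. \<Sum>b\<in>Basis. g b *\<^sub>R b)
      \<in> measurable (\<Pi>\<^sub>M b\<in>(Basis :: (real ^ 'd) set). (lborel :: real measure)) borel"
    by measurable
  have coord: "(\<Sum>b'\<in>Basis. g b' *\<^sub>R b') \<bullet> b = g b"
    if "b \<in> Basis" for g and b :: "real ^ 'd"
    using that by simp
  have m: "(\<lambda>z :: real ^ 'd. \<Prod>b\<in>Basis. f (idx b) (z \<bullet> b)) \<in> borel_measurable borel"
    by measurable
  have cong: "(\<Prod>b\<in>Basis. f (idx b) ((\<Sum>b'\<in>Basis. g b' *\<^sub>R b') \<bullet> b))
      = (\<Prod>b\<in>(Basis :: (real ^ 'd) set). f (idx b) (g b))" for g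
    by (intro prod.cong refl arg_cong[where f = "f _"] coord)
  have "integrable (\<Pi>\<^sub>M b\<in>(Basis :: (real ^ 'd) set). (lborel :: real measure))
      (\<lambda>g. \<Prod>b\<in>Basis. f (idx b) (g b))"
    by (intro product_integrable_prod f) simp
  then show "integrable lborel (\<lambda>z :: real ^ 'd. \<Prod>j\<in>UNIV. f j (z $ j))"
    unfolding eq lborel_eq[where 'a = "real ^ 'd"] integrable_distr_eq[OF emb m] cong .
  have "(LINT z | lborel. (\<Prod>j\<in>UNIV. f j ((z :: real ^ 'd) $ j)))
      = (LINT g | (\<Pi>\<^sub>M b\<in>(Basis :: (real ^ 'd) set). (lborel :: real measure)).
           (\<Prod>b\<in>Basis. f (idx b) (g b)))"
    unfolding eq lborel_eq[where 'a = "real ^ 'd"] integral_distr[OF emb m] cong ..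
  also have "\<dots> = (\<Prod>b\<in>Basis. integral\<^sup>L lborel (f (idx b)))"
    by (intro product_integral_prod f) simp
  also have "\<dots> = (\<Prod>j\<in>UNIV. integral\<^sup>L lborel (f j))"
    using reindex[of "\<lambda>j b. integral\<^sup>L lborel (f j)"] by simp
  finally show "(LINT z | lborel. (\<Prod>j\<in>UNIV. f j ((z :: real ^ 'd) $ j)))
    = (\<Prod>j\<in>UNIV. integral\<^sup>L lborel (f j))" .
qed

definition torus :: "(real ^ 'd) set"
  where "torus = cbox (\<chi> j. - pi) (\<chi> j. pi)"

definition character :: "int ^ 'd \<Rightarrow> real ^ 'd \<Rightarrow> complex"
  where "character x z = exp (\<i> * of_real (\<Sum>j\<in>UNIV. of_int (x $ j) * z $ j))"

text \<open>
  The Fourier multiplier of \<open>neg_laplacian\<close>.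
\<close>

definition laplacian_symbol :: "real ^ 'd \<Rightarrow> real"
  where "laplacian_symbol z = 4 * (\<Sum>j\<in>UNIV. (sin (z $ j / 2))\<^sup>2)"

text \<open>
  The characteristic function of one step of simple random walk.
\<close>

definition walk_symbol :: "real ^ 'd \<Rightarrow> real"
  where "walk_symbol z = (\<Sum>j\<in>UNIV. cos (z $ j)) / CARD('d)"

lemma mem_torus: "z \<in> torus \<longleftrightarrow> (\<forall>j. z $ j \<in> {-pi..pi})"
  by (simp add: torus_def mem_box_cart)

lemma compact_torus: "compact torus"
  by (simp add: torus_def)

lemma torus_borel [measurable]: "torus \<in> sets borel"
  by (simp add: torus_def)

lemma indicator_torus: "(indicator torus z :: real) = (\<Prod>j\<in>UNIV. indicator {-pi..pi} (z $ j))"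
proof (cases "z \<in> torus")
  case False
  then obtain j where "z $ j \<notin> {-pi..pi}" by (auto simp: mem_torus)
  then have "(\<Prod>j\<in>UNIV. indicator {-pi..pi} (z $ j) :: real) = 0"
    by (intro prod_zero bexI[of _ j]) auto
  then show ?thesis using False by simp
qed (auto simp: mem_torus indicator_def)

lemma character_prod: "character x z = (\<Prod>j\<in>UNIV. exp (\<i> * of_real (of_int (x $ j) * z $ j)))"
  unfolding character_def of_real_sum sum_distrib_left by (rule exp_sum) simp

lemma integral_exp_period:
  fixes k :: int
  shows "(LINT t | lborel. indicator {-pi..pi} t *\<^sub>R exp (\<i> * of_real (of_int k * t)))
    = (if k = 0 then 2 * of_real pi else 0)"
proof (cases "k = 0")
  case True
  have "(LINT t | lborel. indicator {-pi..pi} t *\<^sub>R (1 :: complex)) = of_real pi - of_real (- pi)"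
    by (rule integral_FTC_Icc) (auto intro!: derivative_eq_intros simp: has_vector_derivative_of_real)
  with True show ?thesis by simp
next
  case False
  define F where "F = (\<lambda>t :: real. exp (\<i> * of_real (of_int k * t)) / (\<i> * of_int k))"
  have "(LINT t | lborel. indicator {-pi..pi} t *\<^sub>R exp (\<i> * of_real (of_int k * t))) = F pi - F (- pi)"
  proof (rule integral_FTC_Icc)
    fix t :: real
    have "((\<lambda>z. exp (\<i> * of_int k * z) / (\<i> * of_int k)) has_field_derivative
        exp (\<i> * of_int k * of_real t)) (at (of_real t))"
      using False by (auto intro!: derivative_eq_intros)
    then show "(F has_vector_derivative exp (\<i> * of_real (of_int k * t))) (at t within {-pi..pi})"
      unfolding F_def
      by (auto dest: has_vector_derivative_real_field[where s = "{-pi..pi}"] simp: mult.assoc)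
  qed (auto intro!: continuous_intros)
  also have "exp (\<i> * of_real (of_int k * pi)) = exp (\<i> * of_real (of_int k * - pi)) * exp (\<i> * (2 * of_int k * of_real pi))"
    unfolding exp_add[symmetric] by (simp add: algebra_simps)
  then have "F pi - F (- pi) = 0"
    unfolding F_def using exp_integer_2pi[of "of_int k"] by (simp add: algebra_simps)
  finally show ?thesis using False by simp
qed

lemma integral_character:
  fixes x :: "int ^ 'd"
  shows "(LINT z : torus | lborel. character x z) = (if x = 0 then of_real ((2 * pi) ^ CARD('d)) else 0)"
proof -
  let ?f = "\<lambda>j t. indicator {-pi..pi} t *\<^sub>R exp (\<i> * of_real (of_int (x $ j) * t))"
  have int: "integrable lborel (?f j)" for j
    by (intro borel_integrable_compact continuous_intros compact_Icc)
  have "(LINT z : torus | lborel. character x z) = (LINT z | lborel. (\<Prod>j\<in>UNIV. ?f j (z $ j)))"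
    unfolding set_lebesgue_integral_def
    by (simp add: indicator_torus character_prod prod.distrib scaleR_conv_of_real)
  also have "\<dots> = (\<Prod>j\<in>UNIV. integral\<^sup>L lborel (?f j))"
    by (rule integral_lborel_vec_prod[OF int])
  also have "\<dots> = (\<Prod>j\<in>UNIV. if x $ j = 0 then 2 * of_real pi else 0)"
    by (simp only: integral_exp_period)
  also have "\<dots> = (if x = 0 then of_real ((2 * pi) ^ CARD('d)) else 0)"
    by (auto simp: vec_eq_iff)
  finally show ?thesis .
qed

lemma continuous_character [continuous_intros]: "continuous_on S (character x)"
  unfolding character_def by (intro continuous_intros)

lemma continuous_walk_symbol [continuous_intros]: "continuous_on S walk_symbol"
  unfolding walk_symbol_def by (intro continuous_intros) auto

lemma norm_character [simp]: "cmod (character x z) = 1"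
  unfolding character_def by (simp add: norm_exp_i_times)

lemma torus_set_integrable:
  fixes f :: "real ^ 'd \<Rightarrow> 'b::{banach,second_countable_topology}"
  assumes "continuous_on torus f"
  shows "set_integrable lborel torus f"
  unfolding set_integrable_def by (rule borel_integrable_compact[OF compact_torus assms])

lemma symbol_eq_walk_symbol: "laplacian_symbol (z :: real ^ 'd) = 2 * CARD('d) * (1 - walk_symbol z)"
proof -
  have "4 * (sin (t / 2))\<^sup>2 = 2 - 2 * cos t" for t :: real
    using cos_double_sin[of "t / 2"] by simp
  then have "laplacian_symbol z = (\<Sum>j\<in>UNIV. 2 - 2 * cos (z $ j))"
    by (simp add: laplacian_symbol_def sum_distrib_left)
  also have "\<dots> = 2 * CARD('d) - 2 * (\<Sum>j\<in>UNIV. cos (z $ j))"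
    by (simp add: sum_subtractf sum_distrib_left)
  finally show ?thesis by (simp add: walk_symbol_def right_diff_distrib)
qed

text \<open>
  The distribution of simple random walk from the origin after \<open>k\<close> steps, complex valued so that it
  is an argument of \<open>energy_form\<close>.
\<close>

primrec walk :: "nat \<Rightarrow> int ^ 'd \<Rightarrow> complex"
  where "walk 0 x = (if x = 0 then 1 else 0)"
  | "walk (Suc k) x =
      (\<Sum>j\<in>UNIV. walk k (x + axis j 1) + walk k (x - axis j 1)) / of_nat (2 * CARD('d))"

lemma sum_character_neighbours:
  fixes x :: "int ^ 'd"
  shows "(\<Sum>j\<in>UNIV. character (x + axis j 1) z + character (x - axis j 1) z)
    = of_nat (2 * CARD('d)) * (character x z * of_real (walk_symbol z))"
proof -
  have "(\<Sum>i\<in>UNIV. of_int ((x + axis j 1) $ i) * z $ i) = (\<Sum>i\<in>UNIV. of_int (x $ i) * z $ i) + z $ j"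
    "(\<Sum>i\<in>UNIV. of_int ((x - axis j 1) $ i) * z $ i) = (\<Sum>i\<in>UNIV. of_int (x $ i) * z $ i) - z $ j" for j
  proof -
    have "(\<Sum>i\<in>UNIV. of_int ((axis j 1 :: int ^ 'd) $ i) * z $ i) = (\<Sum>i\<in>UNIV. if i = j then z $ i else 0)"
      by (intro sum.cong) (auto simp: axis_def)
    then have *: "(\<Sum>i\<in>UNIV. of_int ((axis j 1 :: int ^ 'd) $ i) * z $ i) = z $ j" by simp
    show "(\<Sum>i\<in>UNIV. of_int ((x + axis j 1) $ i) * z $ i) = (\<Sum>i\<in>UNIV. of_int (x $ i) * z $ i) + z $ j"
      using * by (simp add: ring_distribs sum.distrib)
    show "(\<Sum>i\<in>UNIV. of_int ((x - axis j 1) $ i) * z $ i) = (\<Sum>i\<in>UNIV. of_int (x $ i) * z $ i) - z $ j"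
      using * by (simp add: ring_distribs sum_subtractf)
  qed
  then have "character (x + axis j 1) z + character (x - axis j 1) z
      = character x z * of_real (2 * cos (z $ j))" for j
    unfolding character_def
    by (simp add: exp_add exp_diff ring_distribs right_diff_distrib exp_minus cos_exp_eq cos_of_real[symmetric] del: of_real_sum)
       (simp add: field_simps)
  then show ?thesis
    by (simp add: walk_symbol_def sum_distrib_left[symmetric] flip: of_real_sum)
qed

text \<open>
  One step of the walk averages over neighbours, which multiplies the integrand by \<open>walk_symbol\<close>.
\<close>

lemma walk_Fourier:
  fixes x :: "int ^ 'd"
  shows "walk k x = of_real (1 / (2 * pi) ^ CARD('d)) *
    (LINT z : torus | lborel. character x z * of_real (walk_symbol z ^ k))"
proof (induction k arbitrary: x)
  case 0
  show ?case by (simp add: integral_character)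
next
  case (Suc k)
  have int: "set_integrable lborel torus (\<lambda>z. character y z * of_real (walk_symbol z ^ k))"
    for y :: "int ^ 'd"
    by (intro torus_set_integrable continuous_intros)
  let ?I = "\<lambda>y :: int ^ 'd. LINT z : torus | lborel. character y z * of_real (walk_symbol z ^ k)"
  have "(\<Sum>j\<in>UNIV. ?I (x + axis j 1) + ?I (x - axis j 1))
      = (LINT z : torus | lborel. (\<Sum>j\<in>UNIV. character (x + axis j 1) z * of_real (walk_symbol z ^ k)
          + character (x - axis j 1) z * of_real (walk_symbol z ^ k)))"
    using int unfolding set_lebesgue_integral_def set_integrable_def
    by (simp add: scaleR_sum_right scaleR_add_right Bochner_Integration.integral_sum)
  also have "\<dots> = (LINT z : torus | lborel. of_nat (2 * CARD('d)) * (character x z * of_real (walk_symbol z ^ Suc k)))"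
    by (simp only: distrib_right[symmetric] sum_distrib_right[symmetric] sum_character_neighbours)
       (simp add: algebra_simps)
  also have "\<dots> = of_nat (2 * CARD('d)) * (LINT z : torus | lborel. character x z * of_real (walk_symbol z ^ Suc k))"
    by (rule set_integral_mult_right)
  finally have *: "(\<Sum>j\<in>UNIV. ?I (x + axis j 1) + ?I (x - axis j 1))
      = of_nat (2 * CARD('d)) * (LINT z : torus | lborel. character x z * of_real (walk_symbol z ^ Suc k))" .
  have "walk (Suc k) x = of_real (1 / (2 * pi) ^ CARD('d)) *
      (\<Sum>j\<in>UNIV. ?I (x + axis j 1) + ?I (x - axis j 1)) / of_nat (2 * CARD('d))"
    by (simp only: walk.simps Suc.IH sum_distrib_left distrib_left)
  then show ?case unfolding * by simp
qed

text \<open>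
  Coordinate hyperplanes are null sets. The values \<open>0\<close> and \<open>\<plusminus>\<pi>\<close> have to be avoided, since
  \<open>\<bar>walk_symbol z\<bar> = 1\<close> when all coordinates are \<open>0\<close> and when all are \<open>\<plusminus>\<pi>\<close> (the latter
  reflects the bipartite lattice).
\<close>

lemma AE_vec_coordinate_notin:
  assumes "finite C"
  shows "AE z :: real ^ 'd in lborel. \<forall>j. z $ j \<notin> C"
proof -
  have "AE z :: real ^ 'd in lborel. z $ j \<noteq> c" for j c
  proof -
    have "negligible {z :: real ^ 'd. z $ j = c}" 
      by (simp add: cart_eq_inner_axis negligible_standard_hyperplane)
    then have "AE z in lebesgue. z \<notin> {z :: real ^ 'd. z $ j = c}"
      by (intro AE_not_in) (simp add: negligible_iff_null_sets)
    then show ?thesis by (simp add: AE_completion_iff)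
  qed
  then have "AE z :: real ^ 'd in lborel. \<forall>j. \<forall>c\<in>C. z $ j \<noteq> c"
    using assms by (simp add: AE_finite_all AE_all_countable)
  then show ?thesis by eventually_elim auto
qed

lemma abs_walk_symbol_less_1:
  fixes z :: "real ^ 'd"
  assumes "z \<in> torus" "\<forall>j. z $ j \<notin> {- pi, 0, pi}"
  shows "\<bar>walk_symbol z\<bar> < 1"
proof -
  have c: "\<bar>cos (z $ j)\<bar> < 1" for j
  proof -
    have r: "0 < \<bar>z $ j\<bar>" "\<bar>z $ j\<bar> < pi"
      using assms by (auto simp: mem_torus abs_if less_le dest: spec[of _ j])
    have "cos \<bar>z $ j\<bar> < cos 0" using r by (intro cos_monotone_0_pi) auto
    moreover have "cos pi < cos \<bar>z $ j\<bar>" using r by (intro cos_monotone_0_pi) auto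
    ultimately show ?thesis by (simp add: abs_less_iff)
  qed
  have "\<bar>\<Sum>j\<in>UNIV. cos (z $ j)\<bar> \<le> (\<Sum>j\<in>UNIV. \<bar>cos (z $ j)\<bar>)" by (rule sum_abs)
  also have "\<dots> < (\<Sum>j\<in>(UNIV :: 'd set). 1)" by (rule sum_strict_mono) (auto simp: c)
  finally show ?thesis by (simp add: walk_symbol_def)
qed

text \<open>
  A crude form of Jordan's inequality, from the cubic Taylor bound \<open>s - s ^ 3 / 6 \<le> sin s\<close> and
  \<open>s\<^sup>2 \<le> 3\<close>.
\<close>

lemma half_le_sin:
  assumes "0 \<le> s" "s \<le> pi / 2"
  shows "s / 2 \<le> sin (s :: real)"
proof -
  have "s \<le> 17 / 10" using assms pi_approx by simp
  then have "s * s \<le> 17 / 10 * (17 / 10)" using assms by (intro mult_mono) auto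
  then have "s * (s * s) \<le> s * 3" using assms by (intro mult_left_mono) auto
  moreover have "\<bar>sin s - (\<Sum>m<3. sin_coeff m * s ^ m)\<bar> \<le> inverse (fact 3) * \<bar>s\<bar> ^ 3"
    by (rule Maclaurin_sin_bound)
  then have "\<bar>sin s - s\<bar> \<le> s ^ 3 / 6"
    using assms by (simp add: eval_nat_numeral sin_coeff_def field_simps)
  ultimately show ?thesis by (simp add: power3_eq_cube abs_le_iff) argo
qed

lemma symbol_ge_sum_squares:
  assumes "z \<in> torus"
  shows "(\<Sum>j\<in>UNIV. (z $ j)\<^sup>2) / 4 \<le> laplacian_symbol z"
proof -
  have "(z $ j)\<^sup>2 / 16 \<le> (sin (z $ j / 2))\<^sup>2" for j
  proof -
    have "\<bar>z $ j\<bar> \<le> pi" using assms by (auto simp: mem_torus abs_le_iff minus_le_iff)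
    then have "\<bar>z $ j\<bar> / 4 \<le> sin (\<bar>z $ j\<bar> / 2)" using half_le_sin[of "\<bar>z $ j\<bar> / 2"] by simp
    then have "(\<bar>z $ j\<bar> / 4)\<^sup>2 \<le> (sin (\<bar>z $ j\<bar> / 2))\<^sup>2" by (intro power_mono) auto
    then show ?thesis by (cases "z $ j \<ge> 0") (auto simp: power_divide)
  qed
  then have "(\<Sum>j\<in>UNIV. (z $ j)\<^sup>2 / 16) \<le> (\<Sum>j\<in>UNIV. (sin (z $ j / 2))\<^sup>2)" by (rule sum_mono)
  then show ?thesis by (simp add: laplacian_symbol_def sum_divide_distrib[symmetric])
qed

text \<open>
  The mean inequality bounds \<open>|z|\<^sup>2\<close> below by a product of functions of single coordinates, so that
  integrability of the inverse symbol becomes a one-dimensional question.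
\<close>

lemma symbol_ge_geometric_mean:
  fixes z :: "real ^ 'd"
  assumes "z \<in> torus" "\<forall>j. z $ j \<noteq> 0"
  shows "(\<Prod>j\<in>UNIV. \<bar>z $ j\<bar> powr (2 / CARD('d))) / 4 \<le> laplacian_symbol z"
proof -
  have "(\<Prod>j\<in>UNIV. \<bar>z $ j\<bar> powr (2 / CARD('d))) = (\<Prod>j\<in>UNIV. (z $ j)\<^sup>2 powr (1 / CARD('d)))"
  proof (rule prod.cong[OF refl])
    fix j
    have "(z $ j)\<^sup>2 = \<bar>z $ j\<bar> powr 2" using assms by (simp add: powr_numeral)
    then show "\<bar>z $ j\<bar> powr (2 / CARD('d)) = (z $ j)\<^sup>2 powr (1 / CARD('d))"
      by (simp only: powr_powr times_divide_eq_right mult_1_right)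
  qed
  also have "\<dots> = (\<Prod>j\<in>UNIV. (z $ j)\<^sup>2) powr (1 / CARD('d))"
    by (rule prod_powr_distrib[symmetric])
  also have "\<dots> \<le> (\<Sum>j\<in>UNIV. (z $ j)\<^sup>2 / CARD('d))"
    by (rule arith_geom_mean) auto
  also have "\<dots> \<le> (\<Sum>j\<in>UNIV. (z $ j)\<^sup>2)"
    by (intro sum_mono) (simp add: divide_le_eq mult_le_cancel_left1)
  finally show ?thesis using symbol_ge_sum_squares[OF assms(1)] by simp
qed

lemma integrable_powr_near_0:
  assumes "a > -1" "c \<ge> 0"
  shows "integrable lborel (\<lambda>t :: real. indicator {0..c} t * t powr a)"
proof (rule integrableI_nonneg)
  have "(\<integral>\<^sup>+t. ennreal (t powr a) * indicator {0..c} t \<partial>lborel) = ennreal (c powr (a + 1) / (a + 1))"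
    by (rule nn_integral_has_integral_lebesgue'[OF _ has_integral_powr_from_0[OF assms]]) simp
  then show "(\<integral>\<^sup>+t. ennreal (indicator {0..c} t * t powr a) \<partial>lborel) < \<infinity>"
    by (simp add: ennreal_mult' mult.commute ennreal_indicator)
qed auto

text \<open>
  The majorant is a product of the one-dimensional singularities \<open>|t| powr (- 2 / d)\<close>, which are
  integrable at \<open>0\<close> exactly when \<open>d > 2\<close>.
\<close>

lemma set_integrable_inverse_symbol:
  assumes d: "CARD('d) \<ge> 3"
  shows "set_integrable lborel torus (\<lambda>z :: real ^ 'd. 1 / laplacian_symbol z)"
proof -
  define a where "a = - (2 / CARD('d))"
  have a: "a > -1" using d by (simp add: a_def field_simps)
  define k where "k = (\<lambda>t :: real. indicator {0..pi} t * t powr a)"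
  define h where "h = (\<lambda>t. k t + k (- t))"
  have k: "integrable lborel k" unfolding k_def by (rule integrable_powr_near_0) (use a in auto)
  then have h: "integrable lborel h" unfolding h_def
    using lborel_integrable_real_affine[of k "-1" 0] by simp
  have "integrable lborel (\<lambda>z :: real ^ 'd. 4 * (\<Prod>j\<in>UNIV. h (z $ j)))"
    by (intro integrable_mult_right integrable_lborel_vec_prod h)
  moreover have "(\<lambda>z :: real ^ 'd. indicator torus z *\<^sub>R (1 / laplacian_symbol z)) \<in> borel_measurable lborel"
    unfolding laplacian_symbol_def by measurable
  moreover have "AE z :: real ^ 'd in lborel. norm (indicator torus z *\<^sub>R (1 / laplacian_symbol z))
      \<le> norm (4 * (\<Prod>j\<in>UNIV. h (z $ j)))"
    using AE_vec_coordinate_notin[OF finite.insertI[OF finite.emptyI], of 0]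
  proof eventually_elim
    case (elim z)
    show ?case
    proof (cases "z \<in> torus")
      case True
      have nz: "\<forall>j. z $ j \<noteq> 0" using elim by auto
      have hz: "\<bar>z $ j\<bar> powr a \<le> h (z $ j)" for j
        using True by (cases "z $ j \<ge> 0") (auto simp: mem_torus h_def k_def indicator_def minus_le_iff)
      define P where "P = (\<Prod>j\<in>UNIV. \<bar>z $ j\<bar> powr (2 / CARD('d)))"
      have P: "P > 0" unfolding P_def using nz by (intro prod_pos) auto
      have "P / 4 \<le> laplacian_symbol z" unfolding P_def by (rule symbol_ge_geometric_mean[OF True nz])
      then have "1 / laplacian_symbol z \<le> 4 / P" "laplacian_symbol z > 0"
        using P by (auto simp: divide_simps)
      moreover have "1 / P = (\<Prod>j\<in>UNIV. \<bar>z $ j\<bar> powr a)"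
        by (simp add: P_def a_def powr_minus_divide prod_dividef)
      moreover have "(\<Prod>j\<in>UNIV. \<bar>z $ j\<bar> powr a) \<le> (\<Prod>j\<in>UNIV. h (z $ j))"
        by (intro prod_mono) (auto simp: hz)
      moreover have "(\<Prod>j\<in>UNIV. \<bar>z $ j\<bar> powr a) \<ge> 0" by (intro prod_nonneg) auto
      ultimately show ?thesis using True by simp
    qed simp
  qed
  ultimately show ?thesis unfolding set_integrable_def by (rule Bochner_Integration.integrable_bound)
qed

text \<open>
  Partial sums of the Green series, the expected number of visits to \<open>x\<close> before time \<open>n\<close>. The divisor
  is the vertex degree, which relates \<open>neg_laplacian\<close> to the generator of the walk.
\<close>

definition walk_green :: "nat \<Rightarrow> int ^ 'd \<Rightarrow> complex"
  where "walk_green n x = (\<Sum>k<n. walk k x) / of_nat (2 * CARD('d))"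

lemma green0_eq:
  "green0 (x :: int ^ 'd) = of_real (1 / (2 * pi) ^ CARD('d)) *
     (LINT z : torus | lborel. character x z / of_real (laplacian_symbol z))"
  by (simp add: green0_def torus_def character_def laplacian_symbol_def)

lemma walk_green_Fourier:
  fixes x :: "int ^ 'd"
  shows "walk_green n x = of_real (1 / (2 * pi) ^ CARD('d)) * (LINT z : torus | lborel.
      character x z * of_real ((\<Sum>k<n. walk_symbol z ^ k) / (2 * CARD('d))))"
proof -
  have int: "set_integrable lborel torus (\<lambda>z. character x z * of_real (walk_symbol z ^ k))" for k
    by (intro torus_set_integrable continuous_intros)
  have "(LINT z : torus | lborel. character x z * of_real ((\<Sum>k<n. walk_symbol z ^ k) / (2 * CARD('d))))
      = (LINT z : torus | lborel. (\<Sum>k<n. character x z * of_real (walk_symbol z ^ k)) / of_nat (2 * CARD('d)))"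
    by (simp add: sum_distrib_left)
  also have "\<dots> = (LINT z : torus | lborel. (\<Sum>k<n. character x z * of_real (walk_symbol z ^ k))) / of_nat (2 * CARD('d))"
    by (rule set_integral_divide_zero)
  also have "(LINT z : torus | lborel. (\<Sum>k<n. character x z * of_real (walk_symbol z ^ k)))
      = (\<Sum>k<n. LINT z : torus | lborel. character x z * of_real (walk_symbol z ^ k))"
    using int unfolding set_lebesgue_integral_def set_integrable_def
    by (simp only: scaleR_sum_right) (rule Bochner_Integration.integral_sum)
  finally show ?thesis by (simp add: walk_green_def walk_Fourier sum_distrib_left)
qed

text \<open>
  Summing the geometric series turns the integrand for \<open>walk_green n\<close> into that for \<open>green0\<close> times
  \<open>1 - walk_symbol z ^ n\<close>, a factor between \<open>0\<close> and \<open>2\<close> that tends to \<open>1\<close> almost everywhere.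
\<close>

lemma walk_green_tendsto_green0:
  fixes x :: "int ^ 'd"
  assumes d: "CARD('d) \<ge> 3"
  shows "(\<lambda>n. walk_green n x) \<longlonglongrightarrow> green0 x"
proof -
  let ?s = "\<lambda>n z :: real ^ 'd.
    indicator torus z *\<^sub>R (character x z * of_real ((\<Sum>k<n. walk_symbol z ^ k) / (2 * CARD('d))))"
  let ?f = "\<lambda>z :: real ^ 'd. indicator torus z *\<^sub>R (character x z / of_real (laplacian_symbol z))"
  let ?w = "\<lambda>z :: real ^ 'd. 2 * (indicator torus z *\<^sub>R (1 / laplacian_symbol z))"
  have [measurable]: "character x \<in> borel_measurable borel" "walk_symbol \<in> borel_measurable borel"
    "laplacian_symbol \<in> borel_measurable borel"
    unfolding character_def walk_symbol_def laplacian_symbol_def by measurable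
  have ae: "AE z :: real ^ 'd in lborel. \<forall>j. z $ j \<notin> {- pi, 0, pi}"
    by (rule AE_vec_coordinate_notin) simp
  have geo: "(\<Sum>k<n. walk_symbol z ^ k) / (2 * CARD('d)) = (1 - walk_symbol z ^ n) / laplacian_symbol z"
    if "\<bar>walk_symbol z\<bar> < 1" for n and z :: "real ^ 'd"
    using that by (subst sum_gp_strict) (auto simp: symbol_eq_walk_symbol)
  have "(\<lambda>n. integral\<^sup>L lborel (?s n)) \<longlonglongrightarrow> integral\<^sup>L lborel ?f"
  proof (rule integral_dominated_convergence[where w = ?w])
    show "integrable lborel ?w"
      using set_integrable_inverse_symbol[OF d] unfolding set_integrable_def
      by (rule integrable_mult_right)
    show "AE z in lborel. (\<lambda>n. ?s n z) \<longlonglongrightarrow> ?f z"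
      using ae
    proof eventually_elim
      case (elim z)
      show ?case
      proof (cases "z \<in> torus")
        case True
        have q: "\<bar>walk_symbol z\<bar> < 1" by (rule abs_walk_symbol_less_1[OF True elim])
        then have "(\<lambda>n. walk_symbol z ^ n) \<longlonglongrightarrow> 0" by (intro LIMSEQ_power_zero) simp
        then have "(\<lambda>n. character x z * of_real ((1 - walk_symbol z ^ n) / laplacian_symbol z))
            \<longlonglongrightarrow> character x z * of_real ((1 - 0) / laplacian_symbol z)"
          by (intro tendsto_intros) (use q in \<open>auto simp: symbol_eq_walk_symbol\<close>)
        then show ?thesis unfolding geo[OF q] using True by simp
      qed simp
    qed
    show "AE z in lborel. norm (?s n z) \<le> ?w z" for n
      using ae
    proof eventually_elim
      case (elim z)
      show ?case
      proof (cases "z \<in> torus")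
        case True
        have q: "\<bar>walk_symbol z\<bar> < 1" by (rule abs_walk_symbol_less_1[OF True elim])
        then have "\<bar>walk_symbol z ^ n\<bar> \<le> 1" by (simp add: power_abs power_le_one)
        then have "\<bar>1 - walk_symbol z ^ n\<bar> \<le> 2" by linarith
        moreover have "laplacian_symbol z > 0" using q by (simp add: symbol_eq_walk_symbol)
        ultimately have "\<bar>(1 - walk_symbol z ^ n) / laplacian_symbol z\<bar> \<le> 2 / laplacian_symbol z"
          by (simp add: divide_right_mono)
        moreover have "norm (?s n z) = \<bar>(1 - walk_symbol z ^ n) / laplacian_symbol z\<bar>"
          unfolding geo[OF q] using True by (simp only: norm_scaleR norm_mult norm_character norm_of_real) simp
        ultimately show ?thesis using True by simp
      qed simp
    qed
  qed measurable
  then show ?thesis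
    unfolding walk_green_Fourier green0_eq set_lebesgue_integral_def by (intro tendsto_intros)
qed

section \<open>The Green function as reproducing kernel\<close>

lemma finite_support_walk: "finite {x :: int ^ 'd. walk k x \<noteq> 0}"
proof (induction k)
  case 0
  show ?case by simp
next
  case (Suc k)
  have "{x :: int ^ 'd. walk (Suc k) x \<noteq> 0} \<subseteq>
      (\<Union>j. (\<lambda>x. x - axis j 1) ` {x. walk k x \<noteq> 0} \<union> (\<lambda>x. x + axis j 1) ` {x. walk k x \<noteq> 0})"
  proof
    fix x :: "int ^ 'd" assume "x \<in> {x. walk (Suc k) x \<noteq> 0}"
    then have "(\<Sum>j\<in>UNIV. walk k (x + axis j 1) + walk k (x - axis j 1)) \<noteq> 0" by simp
    then obtain j where "walk k (x + axis j 1) + walk k (x - axis j 1) \<noteq> 0"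
      using sum.not_neutral_contains_not_neutral by blast
    then have "walk k (x + axis j 1) \<noteq> 0 \<or> walk k (x - axis j 1) \<noteq> 0" by auto
    then have "x \<in> (\<lambda>x. x - axis j 1) ` {x. walk k x \<noteq> 0}
        \<union> (\<lambda>x. x + axis j 1) ` {x. walk k x \<noteq> 0}"
      using image_eqI[of x "\<lambda>x. x - axis j 1" "x + axis j 1" "{x. walk k x \<noteq> 0}"]
        image_eqI[of x "\<lambda>x. x + axis j 1" "x - axis j 1" "{x. walk k x \<noteq> 0}"] by simp blast
    then show "x \<in> (\<Union>j. (\<lambda>x. x - axis j 1) ` {x. walk k x \<noteq> 0}
        \<union> (\<lambda>x. x + axis j 1) ` {x. walk k x \<noteq> 0})"
      by blast
  qed
  then show ?case by (rule finite_subset) (auto simp: Suc.IH)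
qed

lemma finite_support_walk_green: "finite {x :: int ^ 'd. walk_green n x \<noteq> 0}"
proof (rule finite_subset)
  show "{x :: int ^ 'd. walk_green n x \<noteq> 0} \<subseteq> (\<Union>k<n. {x. walk k x \<noteq> 0})"
  proof
    fix x :: "int ^ 'd" assume "x \<in> {x. walk_green n x \<noteq> 0}"
    then have "(\<Sum>k<n. walk k x) \<noteq> 0" by (simp add: walk_green_def)
    then obtain k where "k < n" "walk k x \<noteq> 0"
      using sum.not_neutral_contains_not_neutral by (metis lessThan_iff)
    then show "x \<in> (\<Union>k<n. {x. walk k x \<noteq> 0})" by auto
  qed
qed (simp add: finite_support_walk)

lemma cnj_walk [simp]: "cnj (walk k x) = walk k x"
  by (induction k arbitrary: x) auto

lemma neg_laplacian_walk: "neg_laplacian (walk k) (x :: int ^ 'd) = of_nat (2 * CARD('d)) * (walk k x - walk (Suc k) x)"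
proof -
  have "of_nat (2 * CARD('d)) * walk (Suc k) x
      = (\<Sum>j\<in>UNIV. walk k (x + axis j 1)) + (\<Sum>j\<in>UNIV. walk k (x - axis j 1))"
    by (simp add: sum.distrib)
  then show ?thesis
    by (simp add: neg_laplacian_def right_diff_distrib sum_subtractf del: walk.simps)
qed

lemma neg_laplacian_sum_divide: "neg_laplacian (\<lambda>x. (\<Sum>k\<in>K. f k x) / c) x = (\<Sum>k\<in>K. neg_laplacian (f k) x) / c"
  unfolding neg_laplacian_def
  by (subst sum.swap)
     (simp add: sum_divide_distrib sum_distrib_left sum_subtractf diff_divide_distrib)

text \<open>
  The Green series telescopes under \<open>neg_laplacian\<close>: what remains is the initial point mass minus
  the distribution at time \<open>n\<close>.
\<close>

lemma neg_laplacian_walk_green: "neg_laplacian (walk_green n) (x :: int ^ 'd) = (if x = 0 then 1 else 0) - walk n x"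
proof -
  have "neg_laplacian (walk_green n) x = (\<Sum>k<n. walk k x - walk (Suc k) x)"
    unfolding walk_green_def[abs_def] neg_laplacian_sum_divide neg_laplacian_walk
    by (simp add: sum_distrib_left[symmetric] del: walk.simps)
  also have "\<dots> = walk 0 x - walk n x" by (rule sum_lessThan_telescope')
  finally show ?thesis by simp
qed

text \<open>
  The \<open>\<ell>\<^sup>2\<close> pairing of the distributions at times \<open>j\<close> and \<open>k\<close>. The dimension occurs only in the bound
  variable, hence the type argument.
\<close>

definition walk_pairing :: "'d::finite itself \<Rightarrow> nat \<Rightarrow> nat \<Rightarrow> complex"
  where "walk_pairing _ j k = (\<Sum>x :: int ^ 'd | walk j x \<noteq> 0. walk j x * walk k x)"

lemma walk_pairing_commute: "walk_pairing TYPE('d::finite) j k = walk_pairing TYPE('d) k j"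
proof -
  have eq: "walk_pairing TYPE('d) j k
      = (\<Sum>x\<in>{x :: int ^ 'd. walk j x \<noteq> 0} \<union> {x. walk k x \<noteq> 0}. walk j x * walk k x)" for j k
    unfolding walk_pairing_def
    by (rule sum.mono_neutral_left) (auto simp: finite_support_walk)
  show ?thesis unfolding eq[of j k] eq[of k j] by (simp add: mult.commute Un_commute)
qed

lemma energy_form_walk:
  "energy_form (walk j) (walk k :: int ^ 'd \<Rightarrow> complex)
    = of_nat (2 * CARD('d)) * (walk_pairing TYPE('d) j k - walk_pairing TYPE('d) j (Suc k))"
  unfolding energy_form_by_parts[OF finite_support_walk] neg_laplacian_walk walk_pairing_def
  by (simp add: sum_distrib_left sum_subtractf[symmetric] algebra_simps del: walk.simps)

lemma cnj_walk_pairing: "cnj (walk_pairing TYPE('d::finite) j k) = walk_pairing TYPE('d) j k"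
  unfolding walk_pairing_def by (simp del: walk.simps)

text \<open>
  Symmetry of the transition operator, read off from the Hermitian symmetry of \<open>energy_form\<close>: both
  orders of the pairing determine the energy of the same two functions.
\<close>

lemma walk_pairing_Suc:
  "walk_pairing TYPE('d::finite) j (Suc k) = walk_pairing TYPE('d) (Suc j) k"
proof -
  have "energy_form (walk j) (walk k :: int ^ 'd \<Rightarrow> complex) = cnj (energy_form (walk k) (walk j :: int ^ 'd \<Rightarrow> complex))"
    by (rule energy_form_cnj)
  then have "walk_pairing TYPE('d) j k - walk_pairing TYPE('d) j (Suc k)
      = walk_pairing TYPE('d) k j - walk_pairing TYPE('d) k (Suc j)"
    unfolding energy_form_walk by (simp add: cnj_walk_pairing)
  then show ?thesis
    using walk_pairing_commute[where 'd = 'd, of j k]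
      walk_pairing_commute[where 'd = 'd, of k "Suc j"] by simp
qed

text \<open>
  The Chapman-Kolmogorov identity at the origin: all steps are moved to one factor until the other is
  the point mass.
\<close>

lemma walk_pairing_eq: "walk_pairing TYPE('d::finite) j k = walk (j + k) (0 :: int ^ 'd)"
proof (induction j arbitrary: k)
  case 0
  have "{x :: int ^ 'd. walk 0 x \<noteq> 0} = {0}" by auto
  then show ?case unfolding walk_pairing_def by simp
next
  case (Suc j)
  then show ?case using walk_pairing_Suc[where 'd = 'd, of j k] by (simp del: walk.simps)
qed

lemma energy_form_walk_green:
  "energy_form (walk_green m) (walk_green n :: int ^ 'd \<Rightarrow> complex)
    = walk_green m (0 :: int ^ 'd) + walk_green n (0 :: int ^ 'd) - walk_green (m + n) (0 :: int ^ 'd)"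
proof -
  let ?c = "1 / of_nat (2 * CARD('d)) :: complex"
  have fw: "finite_energy (walk k :: int ^ 'd \<Rightarrow> complex)" for k
    by (intro finite_energy_finite_support finite_support_walk)
  have fg: "finite_energy (walk_green k :: int ^ 'd \<Rightarrow> complex)" for k
    by (intro finite_energy_finite_support finite_support_walk_green)
  have eq: "walk_green m = (\<lambda>x :: int ^ 'd. \<Sum>k<m. ?c * walk k x)"
    by (simp add: walk_green_def fun_eq_iff sum_divide_distrib)
  have one: "energy_form (walk k) (walk_green n :: int ^ 'd \<Rightarrow> complex) = walk k (0 :: int ^ 'd) - walk (k + n) (0 :: int ^ 'd)" for k
  proof -
    let ?S = "{x :: int ^ 'd. walk k x \<noteq> 0}"
    have cnj_lap: "cnj (neg_laplacian (walk_green n) x) = (if x = 0 then 1 else 0) - walk n x" for x :: "int ^ 'd"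
      by (simp add: neg_laplacian_walk_green)
    have "energy_form (walk k) (walk_green n :: int ^ 'd \<Rightarrow> complex)
        = (\<Sum>x\<in>?S. walk k x * (if x = 0 then 1 else 0)) - walk_pairing TYPE('d) k n"
      unfolding energy_form_by_parts[OF finite_support_walk] cnj_lap walk_pairing_def
      by (simp only: right_diff_distrib sum_subtractf)
    also have "(\<Sum>x\<in>?S. walk k x * (if x = 0 then 1 else 0)) = walk k (0 :: int ^ 'd)"
      using finite_support_walk[where 'd = 'd, of k] by (simp add: if_distrib cong: if_cong)
    finally show ?thesis by (simp add: walk_pairing_eq)
  qed
  have "energy_form (walk_green m) (walk_green n :: int ^ 'd \<Rightarrow> complex)
      = (\<Sum>k<m. ?c * (walk k (0 :: int ^ 'd) - walk (k + n) (0 :: int ^ 'd)))"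
    unfolding eq by (subst energy_form_sum_left) (auto simp: fw fg one)
  also have "\<dots> = ?c * (\<Sum>k<m. walk k (0 :: int ^ 'd)) - ?c * (\<Sum>k<m. walk (k + n) (0 :: int ^ 'd))"
    by (simp add: sum_distrib_left sum_subtractf right_diff_distrib)
  also have "(\<Sum>k<m. walk (k + n) (0 :: int ^ 'd)) = (\<Sum>k<m + n. walk k (0 :: int ^ 'd)) - (\<Sum>k<n. walk k (0 :: int ^ 'd))"
    by (induction m) (auto simp del: walk.simps)
  finally show ?thesis by (simp add: walk_green_def[of _ 0] diff_divide_distrib)
qed

text \<open>
  The energy of the difference is a second difference of the values at the origin. Hence pointwise
  convergence at the origin alone forces convergence in energy.
\<close>

lemma Q0_walk_green_diff:
  "of_real (Q0 (\<lambda>x :: int ^ 'd. walk_green m x - walk_green n x))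
    = 2 * walk_green (m + n) (0 :: int ^ 'd) - walk_green (m + m) (0 :: int ^ 'd)
      - walk_green (n + n) (0 :: int ^ 'd)"
proof -
  have fg: "finite_energy (walk_green k :: int ^ 'd \<Rightarrow> complex)" for k
    by (intro finite_energy_finite_support finite_support_walk_green)
  have fd: "finite_energy (\<lambda>x :: int ^ 'd. walk_green m x - walk_green n x)"
    by (intro finite_energy_diff fg)
  have cg: "cnj (walk_green k (0 :: int ^ 'd)) = walk_green k (0 :: int ^ 'd)" for k
    by (simp add: walk_green_def)
  let ?d = "\<lambda>x :: int ^ 'd. walk_green m x - walk_green n x"
  have right: "energy_form ?d (walk_green k) = walk_green m (0 :: int ^ 'd) - walk_green n (0 :: int ^ 'd)
      - walk_green (m + k) (0 :: int ^ 'd) + walk_green (n + k) (0 :: int ^ 'd)" for k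
    by (simp add: energy_form_diff_left fg energy_form_walk_green)
  have "of_real (Q0 ?d) = energy_form ?d ?d" by (rule energy_form_self[OF fd, symmetric])
  also have "\<dots> = energy_form (walk_green m) ?d - energy_form (walk_green n) ?d"
    by (rule energy_form_diff_left[OF fg fg fd])
  also have "\<dots> = cnj (energy_form ?d (walk_green m)) - cnj (energy_form ?d (walk_green n))"
    by (simp only: energy_form_cnj[of "walk_green _" ?d])
  finally show ?thesis by (simp add: right cg add.commute)
qed

lemma green0_in_H1:
  assumes "CARD('d::finite) \<ge> 3"
  shows "(green0 :: int ^ 'd \<Rightarrow> complex) \<in> H1"
  unfolding H1_def mem_Collect_eq
proof (intro exI[of _ walk_green] conjI allI impI finite_support_walk_green
    walk_green_tendsto_green0[OF assms])
  fix e :: real assume "e > 0"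
  then have "e\<^sup>2 / 4 > 0" by simp
  from LIMSEQ_D[OF walk_green_tendsto_green0[OF assms, of "0 :: int ^ 'd"] this]
  obtain N where "\<forall>n\<ge>N. cmod (walk_green n (0 :: int ^ 'd) - green0 (0 :: int ^ 'd)) < e\<^sup>2 / 4" ..
  then have N: "\<And>n. n \<ge> N \<Longrightarrow> cmod (walk_green n (0 :: int ^ 'd) - green0 (0 :: int ^ 'd)) < e\<^sup>2 / 4"
    by simp
  have "H1_norm (\<lambda>x :: int ^ 'd. walk_green m x - walk_green n x) < e" if "m \<ge> N" "n \<ge> N" for m n
  proof -
    let ?Q = "Q0 (\<lambda>x :: int ^ 'd. walk_green m x - walk_green n x)"
    let ?g = "\<lambda>k. walk_green k (0 :: int ^ 'd) - green0 (0 :: int ^ 'd)"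
    have "?Q = cmod (of_real ?Q)" by simp
    also have "of_real ?Q = ?g (m + n) + ?g (m + n) - ?g (m + m) - ?g (n + n)"
      unfolding Q0_walk_green_diff by simp
    also have "cmod \<dots> \<le> cmod (?g (m + n)) + cmod (?g (m + n)) + cmod (?g (m + m)) + cmod (?g (n + n))"
      using norm_triangle_ineq4[of "?g (m + n) + ?g (m + n) - ?g (m + m)" "?g (n + n)"]
        norm_triangle_ineq4[of "?g (m + n) + ?g (m + n)" "?g (m + m)"]
        norm_triangle_ineq[of "?g (m + n)" "?g (m + n)"] by linarith
    also have "\<dots> < e\<^sup>2"
      using N[of "m + n"] N[of "m + m"] N[of "n + n"] that by simp
    finally have "?Q < e\<^sup>2" .
    then show ?thesis unfolding H1_norm_def using \<open>e > 0\<close> by (simp add: real_less_lsqrt)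
  qed
  then show "\<exists>N. \<forall>m\<ge>N. \<forall>n\<ge>N. H1_norm (\<lambda>x :: int ^ 'd. walk_green m x - walk_green n x) < e"
    by blast
qed

text \<open>
  The defect \<open>walk n x\<close> in \<open>neg_laplacian_walk_green\<close> is a multiple of a difference of consecutive
  terms of the convergent sequence \<open>walk_green n x\<close>, so it vanishes in the limit.
\<close>

lemma neg_laplacian_green0:
  assumes "CARD('d::finite) \<ge> 3"
  shows "neg_laplacian green0 (x :: int ^ 'd) = (if x = 0 then 1 else 0)"
proof (rule LIMSEQ_unique)
  note lim = walk_green_tendsto_green0[OF assms]
  show "(\<lambda>n. neg_laplacian (walk_green n) x) \<longlonglongrightarrow> neg_laplacian green0 x"
    unfolding neg_laplacian_def by (intro tendsto_intros lim)
  have walk: "walk n x = of_nat (2 * CARD('d)) * (walk_green (Suc n) x - walk_green n x)" for n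
    by (simp add: walk_green_def diff_divide_distrib[symmetric] del: walk.simps)
  have "(\<lambda>n. walk n x) \<longlonglongrightarrow> of_nat (2 * CARD('d)) * (green0 x - green0 x)"
    unfolding walk by (intro tendsto_intros lim LIMSEQ_Suc)
  then have "(\<lambda>n. (if x = 0 then 1 else 0) - walk n x) \<longlonglongrightarrow> (if x = 0 then 1 else 0) - 0"
    by (intro tendsto_intros) simp
  then show "(\<lambda>n. neg_laplacian (walk_green n) x) \<longlonglongrightarrow> (if x = 0 then 1 else 0)"
    by (simp add: neg_laplacian_walk_green)
qed

lemma H1_norm_translate: "H1_norm (\<lambda>x. u (x - y)) = H1_norm u"
proof -
  have "energy_density (\<lambda>x. u (x - y)) = (\<lambda>x. energy_density u (x - y))"
    by (simp add: energy_density_def grad_def fun_eq_iff algebra_simps)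
  moreover have "bij_betw (\<lambda>x. x - y) UNIV UNIV"
    by (rule bij_betw_byWitness[of _ "\<lambda>x. x + y"]) auto
  ultimately show ?thesis
    unfolding H1_norm_def Q0_eq using infsum_reindex_bij_betw[of "\<lambda>x. x - y"] by metis
qed

lemma H1_translate:
  assumes "u \<in> H1" shows "(\<lambda>x. u (x - y)) \<in> H1"
proof -
  from assms obtain \<phi> where \<phi>: "\<And>n. finite {x. \<phi> n x \<noteq> 0}" "\<And>x. (\<lambda>n. \<phi> n x) \<longlonglongrightarrow> u x"
    "\<forall>\<epsilon>>0. \<exists>N. \<forall>m\<ge>N. \<forall>n\<ge>N. H1_norm (\<lambda>x. \<phi> m x - \<phi> n x) < \<epsilon>"
    unfolding H1_def by blast
  have "{x. \<phi> n (x - y) \<noteq> 0} = (\<lambda>x. x + y) ` {x. \<phi> n x \<noteq> 0}" for n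
    by (auto simp: image_iff intro!: exI[of _ "_ - y"])
  then have "finite {x. \<phi> n (x - y) \<noteq> 0}" for n using \<phi>(1) by simp
  then show ?thesis
    unfolding H1_def mem_Collect_eq using \<phi>(2,3) H1_norm_translate[of "\<lambda>x. \<phi> _ x - \<phi> _ x" y]
    by (intro exI[of _ "\<lambda>n x. \<phi> n (x - y)"]) simp
qed

lemma green_in_H1:
  assumes "CARD('d::finite) \<ge> 3"
  shows "green (y :: int ^ 'd) \<in> H1"
  using H1_translate[OF green0_in_H1[OF assms], of y] by (simp add: green_def[abs_def])

text \<open>
  The reproducing property. For finitely supported \<open>u\<close> it is summation by parts against a
  fundamental solution; both sides are continuous along an approximating sequence, the left one in energy
  and the right one pointwise.
\<close>

lemma energy_form_green:
  fixes u :: "int ^ 'd \<Rightarrow> complex"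
  assumes d: "CARD('d) \<ge> 3" and u: "u \<in> H1"
  shows "energy_form u (green y) = u y"
proof -
  have fg: "finite_energy (green y)" by (intro H1_finite_energy green_in_H1 d)
  have neg_laplacian: "neg_laplacian (green y) x = (if x = y then 1 else 0)" for x
    using neg_laplacian_green0[OF d, of "x - y"] by (simp add: neg_laplacian_def green_def algebra_simps)
  have fin: "energy_form v (green y) = v y" if "finite {x. v x \<noteq> 0}" for v
    using that by (simp add: energy_form_by_parts neg_laplacian if_distrib cong: if_cong)
  from H1E[OF u] obtain \<phi> where \<phi>: "\<And>n. finite {x. \<phi> n x \<noteq> 0}" "\<And>x. (\<lambda>n. \<phi> n x) \<longlonglongrightarrow> u x"
    "(\<lambda>n. H1_norm (\<lambda>x. \<phi> n x - u x)) \<longlonglongrightarrow> 0" by blast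
  have "(\<lambda>n. energy_form (\<phi> n) (green y)) \<longlonglongrightarrow> energy_form u (green y)"
    by (rule H1_energy_form_limit[OF H1_finite_energy[OF u] fg finite_energy_finite_support[OF \<phi>(1)] \<phi>(3)])
  then have "(\<lambda>n. \<phi> n y) \<longlonglongrightarrow> energy_form u (green y)" by (simp add: fin[OF \<phi>(1)])
  then show ?thesis by (rule LIMSEQ_unique[OF _ \<phi>(2)])
qed

lemma
  fixes y :: "int ^ 'd"
  assumes d: "CARD('d) \<ge> 3"
  shows green_diagonal: "green y y = of_real ((mu TYPE('d))\<^sup>2)"
    and Q0_green: "Q0 (green y) = (mu TYPE('d))\<^sup>2"
    and mu_pos: "mu TYPE('d) > 0"
proof -
  have g: "green0 (0 :: int ^ 'd) = of_real (Q0 (green z))" for z :: "int ^ 'd"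
    using energy_form_green[OF d green_in_H1[OF d], of z z]
      energy_form_self[OF H1_finite_energy[OF green_in_H1[OF d, of z]]]
    by (simp add: green_def)
  have mu: "mu TYPE('d) = H1_norm (green z)" for z :: "int ^ 'd"
    unfolding mu_def g[of z] by (simp add: H1_norm_def)
  show Q: "Q0 (green y) = (mu TYPE('d))\<^sup>2" by (simp add: mu[of y] H1_norm_squared)
  show "green y y = of_real ((mu TYPE('d))\<^sup>2)"
    unfolding Q[symmetric] g[symmetric] by (simp add: green_def)
  \<comment> \<open>A norm-zero Green function would make every function of the space vanish at \<open>y\<close>, but a point mass does not.\<close>
  let ?\<delta> = "\<lambda>x :: int ^ 'd. if x = y then 1 else 0 :: complex"
  have \<delta>: "?\<delta> \<in> H1" by (rule H1_finite_support) simp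
  have "1 = cmod (energy_form ?\<delta> (green y))" by (simp add: energy_form_green[OF d \<delta>])
  also have "\<dots> \<le> H1_norm ?\<delta> * mu TYPE('d)"
    unfolding mu[of y] by (intro energy_form_Cauchy_Schwarz H1_finite_energy \<delta> green_in_H1 d)
  finally show "mu TYPE('d) > 0" using H1_norm_nonneg[of "green y"] mu[of y]
    by (cases "mu TYPE('d) = 0") (auto simp: less_le)
qed

section \<open>Bounded operators\<close>

text \<open>
  Boundedness first makes the set of quotients bounded above, so that their supremum is meaningful.
  It also forces \<open>H1_norm (A u) = 0\<close> where \<open>H1_norm u = 0\<close>; there the quotient is \<open>0\<close> by
  convention and carries no information.
\<close>

lemma H1_norm_le_opnorm:
  assumes A: "H1_bounded_operator A" and u: "u \<in> H1"
  shows "H1_norm (A u) \<le> H1_opnorm A * H1_norm u"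
proof -
  from A obtain K where K: "\<And>u. u \<in> H1 \<Longrightarrow> H1_norm (A u) \<le> K * H1_norm u"
    unfolding H1_bounded_operator_def by blast
  show ?thesis
  proof (cases "H1_norm u = 0")
    case True
    then show ?thesis using K[OF u] by simp
  next
    case False
    then have pos: "H1_norm u > 0" using H1_norm_nonneg[of u] by linarith
    have "H1_norm (A v) / H1_norm v \<le> max K 0" if "v \<in> H1" for v
    proof (cases "H1_norm v = 0")
      case False
      then have "H1_norm v > 0" using H1_norm_nonneg[of v] by linarith
      then have "H1_norm (A v) / H1_norm v \<le> K" using K[OF that] by (simp add: divide_le_eq)
      then show ?thesis by simp
    qed simp
    then have "bdd_above ((\<lambda>v. H1_norm (A v) / H1_norm v) ` H1)" by (auto intro!: bdd_aboveI)
    then have "H1_norm (A u) / H1_norm u \<le> H1_opnorm A"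
      unfolding H1_opnorm_def by (rule cSUP_upper[OF u])
    then show ?thesis using pos by (simp add: divide_le_eq)
  qed
qed

lemma H1_bounded_operator_id_minus:
  assumes T: "H1_bounded_operator T"
  shows "H1_bounded_operator (id_minus T)"
proof -
  from T have map: "u \<in> H1 \<Longrightarrow> T u \<in> H1"
    and add: "u \<in> H1 \<Longrightarrow> v \<in> H1 \<Longrightarrow> T (\<lambda>x. u x + v x) = (\<lambda>x. T u x + T v x)"
    and cmult: "u \<in> H1 \<Longrightarrow> T (\<lambda>x. c * u x) = (\<lambda>x. c * T u x)" for u v c
    unfolding H1_bounded_operator_def by blast+
  from T obtain K where K: "\<And>u. u \<in> H1 \<Longrightarrow> H1_norm (T u) \<le> K * H1_norm u"
    unfolding H1_bounded_operator_def by blast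
  have "H1_norm (id_minus T u) \<le> (1 + K) * H1_norm u" if u: "u \<in> H1" for u
  proof -
    have "H1_norm (id_minus T u) \<le> H1_norm u + H1_norm (\<lambda>x. (-1) * T u x)"
      using H1_norm_triangle[OF H1_finite_energy[OF u]
          finite_energy_cmult[OF H1_finite_energy[OF map[OF u]], of "-1"]]
      by (simp add: id_minus_def)
    also have "H1_norm (\<lambda>x. (-1) * T u x) = H1_norm (T u)" by (simp only: H1_norm_cmult) simp
    also have "H1_norm u + H1_norm (T u) \<le> (1 + K) * H1_norm u"
      using K[OF u] by (simp add: algebra_simps)
    finally show ?thesis by simp
  qed
  then have "\<exists>K. \<forall>u\<in>H1. H1_norm (id_minus T u) \<le> K * H1_norm u" by blast
  moreover have "\<forall>u\<in>H1. id_minus T u \<in> H1" by (simp add: id_minus_def H1_diff map)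
  ultimately show ?thesis
    unfolding H1_bounded_operator_def
    by (simp add: id_minus_def add cmult fun_eq_iff algebra_simps)
qed

lemma H1_bounded_operator_zero:
  assumes "H1_bounded_operator A" shows "A (\<lambda>x. 0) = (\<lambda>x. 0)"
proof -
  have "\<forall>c. \<forall>u\<in>H1. A (\<lambda>x. c * u x) = (\<lambda>x. c * A u x)"
    using assms unfolding H1_bounded_operator_def by blast
  from this[rule_format, OF H1_zero, of 0] show ?thesis by simp
qed

lemma H1_bounded_operator_sum:
  assumes A: "H1_bounded_operator A" and "finite F" "\<And>i. i \<in> F \<Longrightarrow> f i \<in> H1"
  shows "A (\<lambda>x. \<Sum>i\<in>F. c i * f i x) = (\<lambda>x. \<Sum>i\<in>F. c i * A (f i) x)"
  using assms(2,3)
proof (induction F)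
  case empty
  show ?case using H1_bounded_operator_zero[OF A] by simp
next
  case (insert i F)
  from A have add: "u \<in> H1 \<Longrightarrow> v \<in> H1 \<Longrightarrow> A (\<lambda>x. u x + v x) = (\<lambda>x. A u x + A v x)"
    and cmult: "u \<in> H1 \<Longrightarrow> A (\<lambda>x. c * u x) = (\<lambda>x. c * A u x)" for u v c
    unfolding H1_bounded_operator_def by blast+
  have "A (\<lambda>x. c i * f i x + (\<Sum>i\<in>F. c i * f i x))
      = (\<lambda>x. A (\<lambda>x. c i * f i x) x + A (\<lambda>x. \<Sum>i\<in>F. c i * f i x) x)"
    using insert by (intro add H1_cmult H1_sum) auto
  then show ?case using insert by (simp add: cmult)
qed

section \<open>The Hardy constant of a weight with weakly sparse support\<close>

text \<open>
  The duality argument. The sum to be estimated appears on both sides, once through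
  \<open>S = \<mu> * energy_form u (A w)\<close> and once through the norm of \<open>w\<close>, and one factor \<open>S\<close> cancels.
\<close>

lemma hardy_inequality_weakly_sparse:
  fixes V :: "int ^ 'd \<Rightarrow> real"
  assumes d: "CARD('d) \<ge> 3" and V0: "\<And>x. V x \<ge> 0" and VM: "\<And>x. V x \<le> M"
    and ws: "weakly_sparse_via {x. V x > 0} T"
  shows "hardy_inequality V ((H1_opnorm (id_minus T))\<^sup>2 * (mu TYPE('d))\<^sup>2 * M)"
proof -
  define A where "A = id_minus T"
  define m where "m = mu TYPE('d)"
  define e where "e = (\<lambda>y. H1_inverse A (green_normalized y))"
  define Y where "Y = {x. V x > 0}"
  have m: "m > 0" unfolding m_def by (rule mu_pos[OF d])
  have M: "M \<ge> 0" using V0[of 0] VM[of 0] by linarith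
  have A: "H1_bounded_operator A" and bij: "bij_betw A H1 H1"
    and B: "H1_bounded_operator (H1_inverse A)"
    and orth: "\<And>y y'. y \<in> Y \<Longrightarrow> y' \<in> Y \<Longrightarrow> energy_form (e y) (e y') = (if y = y' then 1 else 0)"
    using ws H1_bounded_operator_id_minus
    unfolding weakly_sparse_via_def A_def e_def Y_def Let_def by auto
  have gn: "green_normalized y = (\<lambda>x. (1 / of_real m) * green y x)" for y :: "int ^ 'd"
    by (simp add: green_normalized_def fun_eq_iff m_def)
  have gnH: "green_normalized y \<in> H1" for y :: "int ^ 'd"
    unfolding gn by (intro H1_cmult green_in_H1 d)
  have eH: "e y \<in> H1" for y
    using B gnH unfolding e_def H1_bounded_operator_def by blast
  have Ae: "A (e y) = green_normalized y" for y
    using bij gnH[of y] f_inv_into_f[of "green_normalized y" A H1]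
    by (simp add: e_def H1_inverse_def bij_betw_def)
  have key: "(\<Sum>x\<in>F. V x * (cmod (u x))\<^sup>2) \<le> (H1_opnorm A)\<^sup>2 * m\<^sup>2 * M * Q0 u"
    if u: "u \<in> H1" and F: "finite F" for u F
  proof -
    define S where "S = (\<Sum>x\<in>F. V x * (cmod (u x))\<^sup>2)"
    have S0: "S \<ge> 0" unfolding S_def by (intro sum_nonneg mult_nonneg_nonneg V0) auto
    \<comment> \<open>Only points of the support carry orthonormal vectors; the other points do not contribute to \<open>S\<close>.\<close>
    define G where "G = F \<inter> Y"
    have G: "finite G" using F by (simp add: G_def)
    have SG: "S = (\<Sum>y\<in>G. V y * (cmod (u y))\<^sup>2)"
      unfolding S_def G_def
      by (rule sum.mono_neutral_right[OF F]) (auto simp: Y_def V0 not_less antisym)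
    define w where "w = (\<lambda>x. \<Sum>y\<in>G. (of_real (V y) * u y) * e y x)"
    have wH: "w \<in> H1" unfolding w_def by (intro H1_sum G eH)
    have AwH: "A w \<in> H1" using A wH unfolding H1_bounded_operator_def by blast
    have Aw: "A w = (\<lambda>x. \<Sum>y\<in>G. (of_real (V y / m) * u y) * green y x)"
      unfolding w_def by (subst H1_bounded_operator_sum[OF A G eH]) (simp add: Ae gn)
    have "energy_form u (A w) = (\<Sum>y\<in>G. cnj (of_real (V y / m) * u y) * energy_form u (green y))"
      unfolding Aw by (intro energy_form_sum_right G H1_finite_energy green_in_H1 d u)
    also have "\<dots> = (\<Sum>y\<in>G. of_real (V y / m * (cmod (u y))\<^sup>2))"
      by (intro sum.cong refl)
         (simp add: energy_form_green[OF d u] complex_norm_square[symmetric] mult.commute[of "cnj _"] mult.assoc)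
    also have "\<dots> = of_real (S / m)" by (simp add: SG sum_divide_distrib)
    finally have "S / m = cmod (energy_form u (A w))" using S0 m by (simp add: norm_divide)
    also have "\<dots> \<le> H1_norm u * H1_norm (A w)"
      by (intro energy_form_Cauchy_Schwarz H1_finite_energy u AwH)
    also have "\<dots> \<le> H1_norm u * (H1_opnorm A * H1_norm w)"
      by (intro mult_left_mono H1_norm_le_opnorm A wH) simp
    finally have "(S / m)\<^sup>2 \<le> (H1_norm u * (H1_opnorm A * H1_norm w))\<^sup>2"
      using S0 m by (intro power_mono) auto
    then have 1: "S\<^sup>2 \<le> (H1_opnorm A)\<^sup>2 * m\<^sup>2 * Q0 u * Q0 w"
      using m by (simp add: power_mult_distrib H1_norm_squared power_divide divide_le_eq mult_ac)
    have "of_real (Q0 w) = energy_form w w"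
      by (rule energy_form_self[OF H1_finite_energy[OF wH], symmetric])
    also have "\<dots> = (\<Sum>y\<in>G. (of_real (V y) * u y) * energy_form (e y) w)"
      by (subst (1) w_def) (intro energy_form_sum_left G H1_finite_energy eH wH)
    also have "\<dots> = (\<Sum>y\<in>G. (of_real (V y) * u y) * cnj (of_real (V y) * u y))"
    proof (intro sum.cong refl arg_cong2[where f = "(*)"])
      fix y assume y: "y \<in> G"
      have "energy_form (e y) w = (\<Sum>y'\<in>G. cnj (of_real (V y') * u y') * energy_form (e y) (e y'))"
        unfolding w_def by (intro energy_form_sum_right G H1_finite_energy eH)
      also have "\<dots> = (\<Sum>y'\<in>G. if y' = y then cnj (of_real (V y') * u y') else 0)"
        using y by (intro sum.cong refl) (auto simp: orth G_def)
      also have "\<dots> = cnj (of_real (V y) * u y)" using y G by simp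
      finally show "energy_form (e y) w = cnj (of_real (V y) * u y)" .
    qed
    also have "\<dots> = of_real (\<Sum>y\<in>G. V y * (V y * (cmod (u y))\<^sup>2))"
      by (simp only: of_real_sum of_real_mult complex_norm_square complex_cnj_mult
          complex_cnj_complex_of_real mult_ac)
    finally have "Q0 w = (\<Sum>y\<in>G. V y * (V y * (cmod (u y))\<^sup>2))" by (simp only: of_real_eq_iff)
    also have "\<dots> \<le> (\<Sum>y\<in>G. M * (V y * (cmod (u y))\<^sup>2))"
      by (intro sum_mono mult_right_mono VM mult_nonneg_nonneg V0) simp
    also have "\<dots> = M * S" by (simp add: SG sum_distrib_left)
    finally have 2: "Q0 w \<le> M * S" .
    have "S * S \<le> ((H1_opnorm A)\<^sup>2 * m\<^sup>2 * M * Q0 u) * S"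
    proof -
      have "(H1_opnorm A)\<^sup>2 * m\<^sup>2 * Q0 u * Q0 w \<le> (H1_opnorm A)\<^sup>2 * m\<^sup>2 * Q0 u * (M * S)"
        by (intro mult_left_mono 2) simp
      then show ?thesis using 1 by (simp add: power2_eq_square mult_ac)
    qed
    then show ?thesis unfolding S_def[symmetric]
      using S0 M by (cases "S = 0") (auto simp: mult_le_cancel_right)
  qed
  show ?thesis
    unfolding hardy_inequality_def A_def[symmetric] m_def[symmetric]
  proof (intro ballI)
    fix u :: "int ^ 'd \<Rightarrow> complex" assume u: "u \<in> H1"
    have s: "(\<lambda>x. V x * (cmod (u x))\<^sup>2) summable_on UNIV"
      by (rule nonneg_bdd_above_summable_on) (use V0 key[OF u] in \<open>auto simp: bdd_above_def\<close>)
    moreover have "(\<Sum>\<^sub>\<infinity>x. V x * (cmod (u x))\<^sup>2) \<le> (H1_opnorm A)\<^sup>2 * m\<^sup>2 * M * Q0 u"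
      by (rule infsum_le_finite_sums[OF s key[OF u]])
    ultimately show "(\<lambda>x. V x * (cmod (u x))\<^sup>2) summable_on UNIV
      \<and> (\<Sum>\<^sub>\<infinity>x. V x * (cmod (u x))\<^sup>2) \<le> (H1_opnorm A)\<^sup>2 * m\<^sup>2 * M * Q0 u" by simp
  qed
qed

text \<open>
  The test function is \<open>green y\<close>, which maximizes the value at \<open>y\<close> for given energy.
\<close>

lemma hardy_inequality_imp_le:
  fixes V :: "int ^ 'd \<Rightarrow> real"
  assumes d: "CARD('d) \<ge> 3" and V0: "\<And>x. V x \<ge> 0" and H: "hardy_inequality V H"
  shows "(mu TYPE('d))\<^sup>2 * V y \<le> H"
proof -
  let ?m = "mu TYPE('d)"
  let ?f = "\<lambda>x. V x * (cmod (green y x))\<^sup>2"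
  have "?f summable_on UNIV" and le: "(\<Sum>\<^sub>\<infinity>x. ?f x) \<le> H * Q0 (green y)"
    using H green_in_H1[OF d, of y] unfolding hardy_inequality_def by blast+
  then have "sum ?f {y} \<le> (\<Sum>\<^sub>\<infinity>x. ?f x)"
    by (intro finite_sum_le_infsum) (auto simp: V0)
  then have "V y * (?m\<^sup>2)\<^sup>2 \<le> H * ?m\<^sup>2"
    using le unfolding Q0_green[OF d] by (simp add: green_diagonal[OF d] norm_power)
  then have "(?m\<^sup>2 * V y) * ?m\<^sup>2 \<le> H * ?m\<^sup>2" by (simp add: power2_eq_square mult_ac)
  then show ?thesis using mu_pos[OF d] by (simp add: mult_le_cancel_right)
qed

text \<open>
  The inverse takes \<open>green_normalized y\<close>, which has norm 1, to a member of an orthonormal system.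
\<close>

lemma one_le_opnorm_inverse:
  fixes T :: "(int ^ 'd \<Rightarrow> complex) \<Rightarrow> (int ^ 'd \<Rightarrow> complex)"
  assumes d: "CARD('d) \<ge> 3" and ws: "weakly_sparse_via Y T" and y: "y \<in> Y"
  shows "1 \<le> H1_opnorm (H1_inverse (id_minus T))"
proof -
  let ?B = "H1_inverse (id_minus T)" and ?h = "green_normalized y"
  have gn: "?h = (\<lambda>x. (1 / of_real (mu TYPE('d))) * green y x)"
    by (simp add: green_normalized_def fun_eq_iff)
  have hH: "?h \<in> H1" unfolding gn by (intro H1_cmult green_in_H1 d)
  have "H1_norm (green y) = mu TYPE('d)"
    using mu_pos[OF d] by (simp add: H1_norm_def Q0_green[OF d])
  then have h1: "H1_norm ?h = 1"
    unfolding gn H1_norm_cmult using mu_pos[OF d] by (simp add: norm_divide)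
  have B: "H1_bounded_operator ?B" and "energy_form (?B ?h) (?B ?h) = 1"
    using ws y unfolding weakly_sparse_via_def Let_def by auto
  moreover have "?B ?h \<in> H1" using B hH unfolding H1_bounded_operator_def by blast
  ultimately have "Q0 (?B ?h) = 1"
    using energy_form_self[OF H1_finite_energy] by (metis of_real_eq_1_iff)
  then have "1 = H1_norm (?B ?h)" by (simp add: H1_norm_def)
  also have "\<dots> \<le> H1_opnorm ?B * H1_norm ?h" by (rule H1_norm_le_opnorm[OF B hH])
  finally show ?thesis by (simp add: h1)
qed

theorem theorem6p3:
  fixes V :: "int ^ 'd \<Rightarrow> real"
  assumes "CARD('d) \<ge> 3"
    and "\<And>x. V x \<ge> 0"
    and "weakly_sparse {x. V x > 0}"
  shows "(discrete_hardy_weight V \<longleftrightarrow> bounded (range V)) \<and>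
    (discrete_hardy_weight V \<longrightarrow>
      (\<forall>T. weakly_sparse_via {x. V x > 0} T \<longrightarrow>
        inverse ((H1_opnorm (H1_inverse (id_minus T)))\<^sup>2) * (mu TYPE('d))\<^sup>2 * linf_norm V
          \<le> hardy_constant V \<and>
        hardy_constant V
          \<le> (H1_opnorm (id_minus T))\<^sup>2 * (mu TYPE('d))\<^sup>2 * linf_norm V))"
proof -
  note d = assms(1) and V0 = assms(2)
  let ?m = "mu TYPE('d)"
  have m: "?m > 0" by (rule mu_pos[OF d])
  have linf: "linf_norm V = (SUP x. V x)" by (simp add: linf_norm_def V0)
  have bdd: "bounded (range V) \<longleftrightarrow> bdd_above (range V)"
    using V0 by (auto simp: bounded_iff bdd_above_def)
  have le_linf: "V x \<le> linf_norm V" if "bounded (range V)" for x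
    using that unfolding linf bdd by (intro cSUP_upper) auto
  have hardy_le: "?m\<^sup>2 * linf_norm V \<le> H" and hardy_bdd: "bounded (range V)"
    if H: "hardy_inequality V H" for H
  proof -
    have *: "V x \<le> H / ?m\<^sup>2" for x
      using hardy_inequality_imp_le[OF d V0 H, of x] m by (simp add: field_simps)
    then have "linf_norm V \<le> H / ?m\<^sup>2" unfolding linf by (intro cSUP_least) auto
    then show "?m\<^sup>2 * linf_norm V \<le> H" using m by (simp add: field_simps)
    show "bounded (range V)" unfolding bdd using * by (auto intro!: bdd_aboveI)
  qed
  have weight: "discrete_hardy_weight V \<longleftrightarrow> bounded (range V)"
  proof
    assume b: "bounded (range V)"
    obtain T where "weakly_sparse_via {x. V x > 0} T"
      using assms(3) unfolding weakly_sparse_def by blast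
    from hardy_inequality_weakly_sparse[OF d V0 le_linf[OF b] this] show "discrete_hardy_weight V"
      unfolding discrete_hardy_weight_def using V0 by blast
  qed (use hardy_bdd in \<open>auto simp: discrete_hardy_weight_def\<close>)
  moreover have "inverse ((H1_opnorm (H1_inverse (id_minus T)))\<^sup>2) * ?m\<^sup>2 * linf_norm V \<le> hardy_constant V
      \<and> hardy_constant V \<le> (H1_opnorm (id_minus T))\<^sup>2 * ?m\<^sup>2 * linf_norm V"
    if hw: "discrete_hardy_weight V" and ws: "weakly_sparse_via {x. V x > 0} T" for T
  proof
    have b: "bounded (range V)" using hw weight by blast
    have upper: "hardy_inequality V ((H1_opnorm (id_minus T))\<^sup>2 * ?m\<^sup>2 * linf_norm V)"
      by (rule hardy_inequality_weakly_sparse[OF d V0 le_linf[OF b] ws])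
    have lower: "?m\<^sup>2 * linf_norm V \<le> hardy_constant V"
      unfolding hardy_constant_def using upper by (intro cInf_greatest) (auto intro: hardy_le)
    have linf0: "linf_norm V \<ge> 0" using le_linf[OF b, of 0] V0[of 0] by linarith
    have "inverse ((H1_opnorm (H1_inverse (id_minus T)))\<^sup>2) * (?m\<^sup>2 * linf_norm V) \<le> ?m\<^sup>2 * linf_norm V"
    proof (cases "\<exists>y. V y > 0")
      case True
      then obtain y where "y \<in> {x. V x > 0}" by blast
      from one_le_opnorm_inverse[OF d ws this]
      have "inverse ((H1_opnorm (H1_inverse (id_minus T)))\<^sup>2) \<le> 1"
        by (simp add: inverse_le_1_iff one_le_power)
      then show ?thesis using linf0 by (intro mult_left_le_one_le) auto
    next
      case False
      \<comment> \<open>With empty support the operator norm is unrestricted, but both sides vanish.\<close>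
      then have "V = (\<lambda>x. 0)" using V0 by (auto simp: fun_eq_iff not_less antisym)
      then have "linf_norm V = 0" by (simp add: linf_norm_def)
      then show ?thesis by simp
    qed
    then show "inverse ((H1_opnorm (H1_inverse (id_minus T)))\<^sup>2) * ?m\<^sup>2 * linf_norm V \<le> hardy_constant V"
      using lower by (simp add: mult.assoc)
    show "hardy_constant V \<le> (H1_opnorm (id_minus T))\<^sup>2 * ?m\<^sup>2 * linf_norm V"
      unfolding hardy_constant_def
      using upper hardy_le by (intro cInf_lower) (auto intro!: bdd_belowI[of _ "?m\<^sup>2 * linf_norm V"])
  qed
  ultimately show ?thesis by blast
qed

end
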